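(* Let $l\ge1$ and $d=2l$. On the hypercubic lattice $\mathbb{Z}^{d}$ place two qubits, of types $A$ and $B$, on every $l$-cell. For $\alpha\in\{A,B\}$, an $l$-cell $c$ and an $(l+1)$-cell $t$ set $$\tilde U^\alpha_c=X^\alpha_c\prod_{c'}(Z^\alpha_{c'})^{\int\boldsymbol c\cup\boldsymbol c'},\qquad W^\alpha_t=Z^\alpha_{\partial t}=\prod_{c'}(Z^\alpha_{c'})^{(\delta\boldsymbol c')(t)},$$ and define $$A^A_c=\tilde U^A_c\prod_t(W^A_t)^{\int\boldsymbol t\cup_1\boldsymbol c},\qquad A^B_c=\tilde U^B_c\prod_t(W^B_t)^{\int\boldsymbol c\cup_1\boldsymbol t}\prod_{c'}(Z^A_{c'})^{\int\boldsymbol c\cup\boldsymbol c'},$$ $$\overline A^A_c=\tilde U^A_c\prod_t(W^A_t)^{\int\boldsymbol c\cup_1\boldsymbol t}\prod_{c'}(Z^B_{c'})^{\int\boldsymbol c'\cup\boldsymbol c},\qquad \overline A^B_c=\tilde U^B_c\prod_t(W^B_t)^{\int\boldsymbol t\cup_1\boldsymbol c},$$ where $c'$ runs over $l$-cells and $t$ over $(l+1)$-cells. Then the operators $A^\alpha_c$ $(\alpha\in\{A,B\}$, $c$ an $l$-cell$)$ generate an invertible subalgebra: every $A^\alpha_c$ commutes with every $\overline A^\beta_{c'}$, and every single-qubit Pauli operator $X^\alpha_c,Z^\alpha_c$ is, up to a phase, a product of finitely many operators $A^\beta_{c'}$ and $\overline A^{\beta}_{c'}$ supported within a uniformly bounded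 distance of $c$.
   Context: An invertible subalgebra $\mathcal A$ is a subalgebra of the algebra of local operators for which there is a constant $\ell$ such that every operator supported on a set $S$ is a sum of products $ab$ with $a\in\mathcal A$, $b$ in the commutant of $\mathcal A$, both supported in the $\ell$-neighbourhood of $S$. Ordering and phases in the products above are immaterial. An $n$-cell of $\mathbb{Z}^d$ is a pair $(v,I)$, $v\in\mathbb{Z}^d$, $I\subset[d]=\{1,\dots,d\}$, $|I|=n$, representing the cube $v+\{\sum_{i\in I}t_ie_i:t_i\in[0,1]\}$; bold denotes indicator cochains of cells. The mod-2 boundary is $\partial(v,I)=\sum_{i\in I}\big[(v,I\setminus\{i\})+(v+e_i,I\setminus\{i\})\big]$, and $\delta a(c)=a(\partial c)$. For $e_I=\sum_{i\in I}e_i$ and $\mathbb{Z}_2$-cochains $a,b$ of degrees $p,q$: if $p+q=d$, $(a\cup b)(v,[d])=\sum_{I\sqcup J=[d],|I|=p}a(v,I)\,b(v+e_I,J)$; if $p+q=d+1$, $(a\cup_1b)(v,[d])=\sum_{c_0\in[d]}\sum_{I'\sqcup J'=[d]\setminus\{c_0\},|I'|=p-1}a\big(v+\sum_{j\in J',j>c_0}e_j,I'\cup\{c_0\}\big)\,b\big(v+\sum_{i\in I',i<c_0}e_i,J'\cup\{c_0\}\big)$. $\int$ is the sum of values over all $d$-cells, mod 2. *)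

theory Defs
  imports Complex_Main "HOL-Library.Z2"
begin

section \<open>Local operators on an infinite system of qubits\<close>

text \<open>
  A configuration is the set of qubits that are in the state 1. An operator acts on complex-valued
  functions of configurations. An operator supported on \<open>S\<close> is a matrix on the
  configurations of a finite subset \<open>F\<close> of \<open>S\<close>, tensored with the identity on all other qubits.
  Operators are multiplied by composition.
\<close>

type_synonym 'q operator = "('q set \<Rightarrow> complex) \<Rightarrow> ('q set \<Rightarrow> complex)"

definition supported_on :: "'q set \<Rightarrow> 'q operator \<Rightarrow> bool" where
  "supported_on S T \<longleftrightarrow>
     (\<exists>F m. finite F \<and> F \<subseteq> S \<and>
        T = (\<lambda>\<psi> \<sigma>. \<Sum>\<tau>\<in>Pow F. m (\<sigma> \<inter> F) \<tau> * \<psi> ((\<sigma> - F) \<union> \<tau>)))"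

definition local_operators :: "'q set \<Rightarrow> 'q operator set" where
  "local_operators Q = {T. supported_on Q T}"

definition pauli_X :: "'q \<Rightarrow> 'q operator" where
  "pauli_X q = (\<lambda>\<psi> \<sigma>. \<psi> (if q \<in> \<sigma> then \<sigma> - {q} else insert q \<sigma>))"

definition pauli_Z :: "'q \<Rightarrow> 'q operator" where
  "pauli_Z q = (\<lambda>\<psi> \<sigma>. if q \<in> \<sigma> then - \<psi> \<sigma> else \<psi> \<sigma>)"

definition scale_op :: "complex \<Rightarrow> 'q operator \<Rightarrow> 'q operator" where
  "scale_op z T = (\<lambda>\<psi> \<sigma>. z * T \<psi> \<sigma>)"

definition add_op :: "'q operator \<Rightarrow> 'q operator \<Rightarrow> 'q operator" where
  "add_op S T = (\<lambda>\<psi> \<sigma>. S \<psi> \<sigma> + T \<psi> \<sigma>)"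

definition subalgebra :: "'q set \<Rightarrow> 'q operator set \<Rightarrow> bool" where
  "subalgebra Q \<A> \<longleftrightarrow>
     \<A> \<subseteq> local_operators Q \<and> id \<in> \<A> \<and>
     (\<forall>z. \<forall>S\<in>\<A>. scale_op z S \<in> \<A>) \<and>
     (\<forall>S\<in>\<A>. \<forall>T\<in>\<A>. add_op S T \<in> \<A>) \<and>
     (\<forall>S\<in>\<A>. \<forall>T\<in>\<A>. S \<circ> T \<in> \<A>)"

definition commutant :: "'q set \<Rightarrow> 'q operator set \<Rightarrow> 'q operator set" where
  "commutant Q \<A> = {T \<in> local_operators Q. \<forall>S\<in>\<A>. S \<circ> T = T \<circ> S}"

definition neighbourhood :: "'q set \<Rightarrow> ('q \<Rightarrow> 'q \<Rightarrow> int) \<Rightarrow> int \<Rightarrow> 'q set \<Rightarrow> 'q set" where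
  "neighbourhood Q D r S = {q \<in> Q. \<exists>s\<in>S. D s q \<le> r}"

definition invertible_subalgebra ::
    "'q set \<Rightarrow> ('q \<Rightarrow> 'q \<Rightarrow> int) \<Rightarrow> 'q operator set \<Rightarrow> bool" where
  "invertible_subalgebra Q D \<A> \<longleftrightarrow>
     subalgebra Q \<A> \<and>
     (\<exists>r. \<forall>S T. S \<subseteq> Q \<longrightarrow> supported_on S T \<longrightarrow>
        (\<exists>(n::nat) a b.
           (\<forall>i<n. a i \<in> \<A> \<and> supported_on (neighbourhood Q D r S) (a i) \<and>
                  b i \<in> commutant Q \<A> \<and> supported_on (neighbourhood Q D r S) (b i)) \<and>
           T = (\<lambda>\<psi> \<sigma>. \<Sum>i<n. (a i \<circ> b i) \<psi> \<sigma>)))"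

text \<open>
  A product over an infinite index set in which all but finitely many factors are the identity.
  It is used only for pairwise commuting factors.
\<close>

definition op_prod :: "('i \<Rightarrow> 'q operator) \<Rightarrow> 'i set \<Rightarrow> 'q operator" where
  "op_prod f I = Finite_Set.fold (\<lambda>i T. f i \<circ> T) id {i \<in> I. f i \<noteq> id}"

text \<open>Power of an operator of order two with an exponent in \<open>\<int>/2\<close>.\<close>

definition op_pow :: "'q operator \<Rightarrow> bit \<Rightarrow> 'q operator" where
  "op_pow T k = (if k = 1 then T else id)"

section \<open>Cells and mod-2 cochains of the hypercubic lattice\<close>

text \<open>
  A vertex of \<open>\<int>\<^sup>d\<close> is a function that vanishes outside \<open>{1..d}\<close>.
\<close>

type_synonym vertex = "nat \<Rightarrow> int"
type_synonym cell = "vertex \<times> nat set"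
type_synonym cochain = "cell \<Rightarrow> bit"

definition vertices :: "nat \<Rightarrow> vertex set" where
  "vertices d = {v. \<forall>i. i \<notin> {1..d} \<longrightarrow> v i = 0}"

definition cells :: "nat \<Rightarrow> nat \<Rightarrow> cell set" where
  "cells d n = {(v, I). v \<in> vertices d \<and> I \<subseteq> {1..d} \<and> card I = n}"

definition shift :: "vertex \<Rightarrow> nat set \<Rightarrow> vertex" where
  "shift v I = (\<lambda>i. v i + of_bool (i \<in> I))"  \<comment> \<open>\<open>v + e\<^sub>I\<close>\<close>

definition indicator_cochain :: "cell \<Rightarrow> cochain" where
  "indicator_cochain c = (\<lambda>c'. of_bool (c' = c))"

definition coboundary :: "cochain \<Rightarrow> cochain" where
  "coboundary a = (\<lambda>(v, I). \<Sum>i\<in>I. a (v, I - {i}) + a (shift v {i}, I - {i}))"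

text \<open>
  The first argument of the two products below is the degree \<open>p\<close> of the cochain \<open>a\<close>. Only the
  values on \<open>d\<close>-cells, where \<open>K = {1..d}\<close>, are used; the degree of \<open>b\<close> is then \<open>d - p\<close> for
  \<open>cup\<close> and \<open>d + 1 - p\<close> for \<open>cup1\<close>.
\<close>

definition cup :: "nat \<Rightarrow> cochain \<Rightarrow> cochain \<Rightarrow> cochain" where
  "cup p a b = (\<lambda>(v, K).
     \<Sum>(I, J) \<in> {(I, J). I \<union> J = K \<and> I \<inter> J = {} \<and> card I = p}.
       a (v, I) * b (shift v I, J))"

definition cup1 :: "nat \<Rightarrow> cochain \<Rightarrow> cochain \<Rightarrow> cochain" where
  "cup1 p a b = (\<lambda>(v, K).
     \<Sum>c\<in>K. \<Sum>(I, J) \<in> {(I, J). I \<union> J = K - {c} \<and> I \<inter> J = {} \<and> card I = p - 1}.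
       a (shift v {j \<in> J. c < j}, insert c I) * b (shift v {i \<in> I. i < c}, insert c J))"

definition integral :: "nat \<Rightarrow> cochain \<Rightarrow> bit" where
  "integral d a = (\<Sum>c \<in> {c \<in> cells d d. a c \<noteq> 0}. a c)"

section \<open>The generators\<close>

datatype species = Type_A | Type_B

type_synonym qubit = "species \<times> cell"

definition qubits :: "nat \<Rightarrow> qubit set" where
  "qubits l = UNIV \<times> cells (2 * l) l"

text \<open>
  The distance of two qubits is the graph distance of the base vertices of their cells. For fixed
  \<open>l\<close> it agrees with the Euclidean distance of the cubes themselves up to a bounded factor and a
  bounded summand, so "uniformly bounded" means the same for both.
\<close>

definition qubit_dist :: "nat \<Rightarrow> qubit \<Rightarrow> qubit \<Rightarrow> int" where
  "qubit_dist l = (\<lambda>(\<alpha>, v, I) (\<beta>, w, J). \<Sum>i\<in>{1..2 * l}. \<bar>v i - w i\<bar>)"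

definition int_cup :: "nat \<Rightarrow> cell \<Rightarrow> cell \<Rightarrow> bit" where
  "int_cup l c c' = integral (2 * l) (cup l (indicator_cochain c) (indicator_cochain c'))"

definition int_cup1_cell_right :: "nat \<Rightarrow> cell \<Rightarrow> cell \<Rightarrow> bit" where
  "int_cup1_cell_right l t c =
     integral (2 * l) (cup1 (l + 1) (indicator_cochain t) (indicator_cochain c))"

definition int_cup1_cell_left :: "nat \<Rightarrow> cell \<Rightarrow> cell \<Rightarrow> bit" where
  "int_cup1_cell_left l c t =
     integral (2 * l) (cup1 l (indicator_cochain c) (indicator_cochain t))"

definition U_op :: "nat \<Rightarrow> species \<Rightarrow> cell \<Rightarrow> qubit operator" where
  "U_op l \<alpha> c =
     pauli_X (\<alpha>, c) \<circ> op_prod (\<lambda>c'. op_pow (pauli_Z (\<alpha>, c')) (int_cup l c c')) (cells (2 * l) l)"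

definition W_op :: "nat \<Rightarrow> species \<Rightarrow> cell \<Rightarrow> qubit operator" where
  "W_op l \<alpha> t =
     op_prod (\<lambda>c'. op_pow (pauli_Z (\<alpha>, c')) (coboundary (indicator_cochain c') t))
       (cells (2 * l) l)"

fun A_op :: "nat \<Rightarrow> species \<Rightarrow> cell \<Rightarrow> qubit operator" where
  "A_op l Type_A c =
     U_op l Type_A c
     \<circ> op_prod (\<lambda>t. op_pow (W_op l Type_A t) (int_cup1_cell_right l t c)) (cells (2 * l) (l + 1))"
| "A_op l Type_B c =
     U_op l Type_B c
     \<circ> op_prod (\<lambda>t. op_pow (W_op l Type_B t) (int_cup1_cell_left l c t)) (cells (2 * l) (l + 1))
     \<circ> op_prod (\<lambda>c'. op_pow (pauli_Z (Type_A, c')) (int_cup l c c')) (cells (2 * l) l)"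

fun A_bar_op :: "nat \<Rightarrow> species \<Rightarrow> cell \<Rightarrow> qubit operator" where
  "A_bar_op l Type_A c =
     U_op l Type_A c
     \<circ> op_prod (\<lambda>t. op_pow (W_op l Type_A t) (int_cup1_cell_left l c t)) (cells (2 * l) (l + 1))
     \<circ> op_prod (\<lambda>c'. op_pow (pauli_Z (Type_B, c')) (int_cup l c' c)) (cells (2 * l) l)"
| "A_bar_op l Type_B c =
     U_op l Type_B c
     \<circ> op_prod (\<lambda>t. op_pow (W_op l Type_B t) (int_cup1_cell_right l t c)) (cells (2 * l) (l + 1))"

definition A_generators :: "nat \<Rightarrow> qubit operator set" where
  "A_generators l = {A_op l \<alpha> c | \<alpha> c. c \<in> cells (2 * l) l}"

definition A_bar_generators :: "nat \<Rightarrow> qubit operator set" where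
  "A_bar_generators l = {A_bar_op l \<alpha> c | \<alpha> c. c \<in> cells (2 * l) l}"

end

theory Submission
  imports Defs
begin

text \<open>
  Up to a sign, every operator in the theorem is a Pauli operator, that is, a pair of finitely
  supported \<open>\<int>/2\<close>-valued functions on the qubits, and products of operators become sums of such pairs.
  The theorem therefore reduces to linear algebra over \<open>\<int>/2\<close>. For \<open>l\<close>-cells \<open>a\<close> and \<open>x\<close> write
  \<open>C(a,x) = \<integral> a \<union> x\<close>, \<open>P(a,x) = \<integral> \<delta>x \<union>\<^sub>1 a\<close> and \<open>Q(a,x) = \<integral> a \<union>\<^sub>1 \<delta>x\<close>. The operators have the following
  \<open>Z\<close>-parts, as functions of \<open>x\<close>, besides one factor \<open>X\<close> at \<open>a\<close>:
  \<open>A\<^sup>A\<close> has \<open>C + P\<close> on species \<open>A\<close>; \<open>A\<^sup>B\<close> has \<open>C + Q\<close> on \<open>B\<close> and \<open>C\<close> on \<open>A\<close>;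
  the barred \<open>A\<close>-operator has \<open>C + Q\<close> on \<open>A\<close> and the transpose of \<open>C\<close> on \<open>B\<close>; the barred
  \<open>B\<close>-operator has \<open>C + P\<close> on \<open>B\<close>.
  
  The one geometric input is the Leibniz rule for \<open>\<union>\<^sub>1\<close>, integrated over the lattice:
  \<open>C(a,x) + C(x,a) = P(x,a) + Q(a,x)\<close> (\<open>cup1_identity\<close>). It says exactly that barred and unbarred
  operators of the same species commute (\<open>A_op_commutes_A_bar_op\<close>).
  
  For generation, multiply the unbarred by the barred operator of species \<open>\<alpha>\<close> at \<open>a\<close>. The \<open>X\<close> factors and
  the terms \<open>C\<close> cancel, which leaves \<open>P + Q\<close> on species \<open>\<alpha>\<close>, a product of operators \<open>W\<^sup>\<alpha>\<close>, and a single \<open>Z\<close>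
  of the other species \<open>\<beta>\<close>, at the unique cell that pairs with \<open>a\<close> under the cup product
  (\<open>generated_pair\<close>). Sum over the cells \<open>a\<close> of a coboundary \<open>\<delta>e\<close> with \<open>e\<close> an \<open>(l - 1)\<close>-cell. Using the
  Leibniz rule twice, \<open>P(a,x) + Q(a,x) = P(x,a) + Q(x,a)\<close>, and the right-hand side depends on \<open>a\<close> only through
  \<open>\<delta>a\<close>, so the sum vanishes because \<open>\<delta>\<delta> = 0\<close> (\<open>cup1_comm_coboundary\<close>). What is left is
  \<open>\<integral> x \<union> \<delta>e = \<integral> \<delta>x \<union> e\<close> (or the same with the factors exchanged), which is the operator \<open>W\<^sup>\<beta>\<close> of the
  \<open>(l + 1)\<close>-cell paired with \<open>e\<close> (\<open>generated_W\<close>). Once all \<open>W\<close> are available, \<open>generated_pair\<close> yields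
  every \<open>Z\<close> and the operators \<open>A\<close> then yield every \<open>X\<close>, at bounded distance in each step.
  
  Finally, Pauli operators span the local operators, and a product of commuting generators can be
  sorted into an unbarred and a barred part, so invertibility follows from the generation of single Pauli
  operators (\<open>invertible_subalgebra_hull\<close>).
\<close>

section \<open>Pauli operators as vectors over the field with two elements\<close>

text \<open>
  The default simplification rules rewrite sums and products of bits to bitwise operations, which hides the
  field structure used throughout.
\<close>

declare add_bit_eq_xor [simp del] mult_bit_eq_and [simp del]

lemma bit_add_self [simp]: "(x::bit) + x = 0"
  by (cases x) simp_all

lemma bit_add_self_left [simp]: "(x::bit) + (x + y) = y"
  by (simp flip: add.assoc)

definition bit_sign :: "bit \<Rightarrow> complex" where
  "bit_sign b = (if b = 1 then - 1 else 1)"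

lemma bit_sign_add: "bit_sign (a + b) = bit_sign a * bit_sign b"
  by (cases a; cases b) (simp_all add: bit_sign_def)

lemma bit_sign_0 [simp]: "bit_sign 0 = 1"
  by (simp add: bit_sign_def)

lemma norm_bit_sign [simp]: "norm (bit_sign b) = 1"
  by (simp add: bit_sign_def)

lemma bit_sign_square [simp]: "bit_sign b * bit_sign b = 1"
  by (simp add: bit_sign_def)

lemma bit_sign_eq_1_iff [simp]: "bit_sign b = 1 \<longleftrightarrow> b = 0"
  by (cases b) (simp_all add: bit_sign_def)

definition supp :: "('q \<Rightarrow> bit) \<Rightarrow> 'q set" where
  "supp g = {q. g q \<noteq> 0}"

definition chi :: "'q set \<Rightarrow> 'q \<Rightarrow> bit" where
  "chi \<sigma> q = of_bool (q \<in> \<sigma>)"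

definition pairing :: "('q \<Rightarrow> bit) \<Rightarrow> ('q \<Rightarrow> bit) \<Rightarrow> bit" where
  "pairing g h = sum h (supp g)"

definition flip :: "('q \<Rightarrow> bit) \<Rightarrow> 'q set \<Rightarrow> 'q set" where
  "flip f \<sigma> = {q. (q \<in> \<sigma>) \<noteq> (f q = 1)}"

text \<open>
  All \<open>X\<close> factors stand to the left of all \<open>Z\<close> factors. Hence the sign is read off after the flip, and
  multiplying from the right by further \<open>Z\<close> factors produces no sign.
\<close>

definition pauli :: "('q \<Rightarrow> bit) \<Rightarrow> ('q \<Rightarrow> bit) \<Rightarrow> 'q operator" where
  "pauli f g = (\<lambda>\<psi> \<sigma>. bit_sign (pairing g (chi (flip f \<sigma>))) * \<psi> (flip f \<sigma>))"

abbreviation no_qubit :: "'q \<Rightarrow> bit" where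
  "no_qubit \<equiv> (\<lambda>_. 0)"

definition single :: "'q \<Rightarrow> 'q \<Rightarrow> bit" where
  "single q = (\<lambda>q'. of_bool (q' = q))"

lemma supp_zero [simp]: "supp (\<lambda>_. 0) = {}"
  by (simp add: supp_def)

lemma supp_single [simp]: "supp (single q) = {q}"
  by (auto simp: supp_def single_def)

lemma supp_chi [simp]: "supp (chi \<rho>) = \<rho>"
  by (auto simp: supp_def chi_def)

lemma supp_add: "supp (\<lambda>q. f q + g q) \<subseteq> supp f \<union> supp g"
  by (auto simp: supp_def)

lemma supp_sum: "supp (\<lambda>q. \<Sum>i\<in>I. g i q) \<subseteq> (\<Union>i\<in>I. supp (g i))"
proof
  fix q assume "q \<in> supp (\<lambda>q. \<Sum>i\<in>I. g i q)"
  hence "(\<Sum>i\<in>I. g i q) \<noteq> 0" by (simp add: supp_def)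
  then obtain i where "i \<in> I" "g i q \<noteq> 0"
    by (rule sum.not_neutral_contains_not_neutral)
  thus "q \<in> (\<Union>i\<in>I. supp (g i))" by (auto simp: supp_def)
qed

lemma finite_supp_add:
  "finite (supp f) \<Longrightarrow> finite (supp g) \<Longrightarrow> finite (supp (\<lambda>q. f q + g q))"
  by (rule finite_subset[OF supp_add]) simp

lemma finite_supp_sum:
  "finite I \<Longrightarrow> (\<And>i. i \<in> I \<Longrightarrow> finite (supp (g i))) \<Longrightarrow> finite (supp (\<lambda>q. \<Sum>i\<in>I. g i q))"
  by (rule finite_subset[OF supp_sum]) simp

lemma pairing_eq_sum:
  assumes "finite F" "supp g \<subseteq> F"
  shows "pairing g h = (\<Sum>q\<in>F. g q * h q)"
  unfolding pairing_def using assms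
  by (intro sum.mono_neutral_cong_left) (auto simp: supp_def)

lemma pairing_add_left:
  assumes "finite (supp g)" "finite (supp g')"
  shows "pairing (\<lambda>q. g q + g' q) h = pairing g h + pairing g' h"
proof -
  let ?F = "supp g \<union> supp g'"
  have "finite ?F" using assms by simp
  moreover have "supp (\<lambda>q. g q + g' q) \<subseteq> ?F" by (rule supp_add)
  ultimately show ?thesis
    by (simp add: pairing_eq_sum[of ?F] sum.distrib distrib_right)
qed

lemma pairing_add_right: "pairing g (\<lambda>q. h q + h' q) = pairing g h + pairing g h'"
  by (simp add: pairing_def sum.distrib)

lemma pairing_zero_left [simp]: "pairing (\<lambda>_. 0) h = 0"
  by (simp add: pairing_def)

lemma pairing_zero_right [simp]: "pairing g (\<lambda>_. 0) = 0"
  by (simp add: pairing_def)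

lemma pairing_single_left [simp]: "pairing (single q) h = h q"
  by (simp add: pairing_def)

lemma pairing_single_right [simp]:
  assumes "finite (supp g)"
  shows "pairing g (single q) = g q"
  using assms
  by (cases "g q") (auto simp: pairing_eq_sum[of "insert q (supp g)" g] subset_insertI single_def
      of_bool_def if_distrib[of "(*) _"] cong: if_cong)

lemma chi_flip: "chi (flip f \<sigma>) = (\<lambda>q. chi \<sigma> q + f q)"
proof
  fix q show "chi (flip f \<sigma>) q = chi \<sigma> q + f q"
    by (cases "f q") (auto simp: chi_def flip_def)
qed

lemma bit_add_eq_1_iff: "(a::bit) + b = 1 \<longleftrightarrow> (a = 1) \<noteq> (b = 1)"
  by (cases a; cases b) simp_all

lemma flip_flip: "flip f' (flip f \<sigma>) = flip (\<lambda>q. f q + f' q) \<sigma>"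
proof -
  have "q \<in> flip f' (flip f \<sigma>) \<longleftrightarrow> q \<in> flip (\<lambda>q. f q + f' q) \<sigma>" for q
    unfolding flip_def mem_Collect_eq bit_add_eq_1_iff by argo
  thus ?thesis by blast
qed

lemma flip_zero [simp]: "flip (\<lambda>_. 0) \<sigma> = \<sigma>"
  by (simp add: flip_def)

text \<open>
  Moving the \<open>Z\<close> factors of the first operator past the \<open>X\<close> factors of the second gives one sign for every qubit
  that carries both.
\<close>

lemma pauli_comp:
  assumes "finite (supp g)" "finite (supp g')"
  shows "pauli f g \<circ> pauli f' g' =
    scale_op (bit_sign (pairing g f')) (pauli (\<lambda>q. f q + f' q) (\<lambda>q. g q + g' q))"
proof (intro ext)
  fix \<psi> \<sigma>
  let ?\<rho> = "flip (\<lambda>q. f q + f' q) \<sigma>"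
  have "chi (flip f \<sigma>) = (\<lambda>q. chi ?\<rho> q + f' q)"
    by (simp add: chi_flip fun_eq_iff add.assoc)
  thus "(pauli f g \<circ> pauli f' g') \<psi> \<sigma> =
    scale_op (bit_sign (pairing g f')) (pauli (\<lambda>q. f q + f' q) (\<lambda>q. g q + g' q)) \<psi> \<sigma>"
    by (simp add: pauli_def scale_op_def flip_flip pairing_add_right pairing_add_left assms
        bit_sign_add)
qed

lemma pauli_comp_Z:
  assumes "finite (supp g)" "finite (supp g')"
  shows "pauli f g \<circ> pauli no_qubit g' = pauli f (\<lambda>q. g q + g' q)"
  using pauli_comp[OF assms, of f "\<lambda>_. 0"] by (simp add: scale_op_def)

lemma pauli_commute:
  assumes "finite (supp g)" "finite (supp g')" "pairing g f' = pairing g' f"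
  shows "pauli f g \<circ> pauli f' g' = pauli f' g' \<circ> pauli f g"
  by (simp add: pauli_comp assms add.commute)

lemma pauli_X_eq: "pauli_X q = pauli (single q) no_qubit"
proof -
  have "flip (single q) \<sigma> = (if q \<in> \<sigma> then \<sigma> - {q} else insert q \<sigma>)" for \<sigma>
    by (auto simp: flip_def single_def)
  thus ?thesis by (simp add: pauli_X_def pauli_def)
qed

lemma pauli_Z_eq: "pauli_Z q = pauli no_qubit (single q)"
  by (auto simp: pauli_Z_def pauli_def fun_eq_iff chi_def bit_sign_def)

lemma id_eq_pauli: "id = pauli no_qubit no_qubit"
  by (simp add: pauli_def fun_eq_iff)

lemma pauli_Z_inj:
  assumes "finite (supp g)" "pauli no_qubit g = id"
  shows "g = no_qubit"
proof
  fix q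
  have "pauli no_qubit g (\<lambda>_. 1) {q} = 1" using assms(2) by simp
  moreover have "chi {q} = single q"
    by (simp add: chi_def single_def fun_eq_iff)
  ultimately show "g q = 0" by (simp add: pauli_def assms(1))
qed

section \<open>Products of commuting Z operators\<close>

text \<open>
  The product ranges over the factors that differ from the identity, all of which lie in \<open>K\<close>; by
  \<open>pauli_Z_inj\<close> the other members of \<open>K\<close> contribute nothing to the sum.
\<close>

lemma op_prod_Z:
  assumes f: "\<And>i. i \<in> I \<Longrightarrow> f i = pauli no_qubit (g i)"
    and g: "\<And>i. i \<in> I \<Longrightarrow> finite (supp (g i))"
    and K: "finite K" "K \<subseteq> I" "\<And>i q. i \<in> I - K \<Longrightarrow> g i q = 0"
  shows "op_prod f I = pauli no_qubit (\<lambda>q. \<Sum>i\<in>K. g i q)"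
proof -
  define M where "M = {i \<in> I. f i \<noteq> id}"
  have "i \<in> K" if "i \<in> M" for i
  proof (rule ccontr)
    assume "i \<notin> K"
    hence "g i = no_qubit" using that K(3) by (auto simp: M_def)
    thus False using that f[of i] by (simp add: M_def id_eq_pauli)
  qed
  hence "M \<subseteq> K" by blast
  hence "finite M" using K(1) finite_subset by blast
  interpret comp_fun_commute_on I "\<lambda>i T. f i \<circ> T"
  proof
    fix i j assume ij: "i \<in> I" "j \<in> I"
    have "f i \<circ> f j = f j \<circ> f i"
      using ij by (simp add: f g pauli_commute)
    thus "(\<lambda>T. f j \<circ> T) \<circ> (\<lambda>T. f i \<circ> T) = (\<lambda>T. f i \<circ> T) \<circ> (\<lambda>T. f j \<circ> T)"
      by (simp add: fun_eq_iff)
  qed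
  have "Finite_Set.fold (\<lambda>i T. f i \<circ> T) id L = pauli no_qubit (\<lambda>q. \<Sum>i\<in>L. g i q)"
    if "finite L" "L \<subseteq> I" for L
    using that
  proof (induction L)
    case empty
    show ?case by (simp add: id_eq_pauli)
  next
    case (insert i L)
    have "finite (supp (\<lambda>q. \<Sum>i\<in>L. g i q))"
      using insert by (intro finite_supp_sum g) auto
    hence "f i \<circ> pauli no_qubit (\<lambda>q. \<Sum>i\<in>L. g i q) =
      pauli no_qubit (\<lambda>q. \<Sum>i\<in>insert i L. g i q)"
      using insert by (simp add: f g pauli_comp_Z)
    hence "f i \<circ> Finite_Set.fold (\<lambda>i T. f i \<circ> T) id L =
      pauli no_qubit (\<lambda>q. \<Sum>i\<in>insert i L. g i q)"
      using insert.IH insert.prems by (metis insert_subset)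
    moreover have "Finite_Set.fold (\<lambda>i T. f i \<circ> T) id (insert i L) =
      f i \<circ> Finite_Set.fold (\<lambda>i T. f i \<circ> T) id L"
      using insert by (intro fold_insert) auto
    ultimately show ?case by (simp only:)
  qed
  hence "op_prod f I = pauli no_qubit (\<lambda>q. \<Sum>i\<in>M. g i q)"
    using \<open>finite M\<close> by (simp add: op_prod_def M_def)
  also have "(\<lambda>q. \<Sum>i\<in>M. g i q) = (\<lambda>q. \<Sum>i\<in>K. g i q)"
  proof
    fix q
    have "g i q = 0" if "i \<in> K - M" for i
    proof -
      have "i \<in> I" "pauli no_qubit (g i) = id" using that K(2) f by (auto simp: M_def)
      thus ?thesis using pauli_Z_inj g by metis
    qed
    thus "(\<Sum>i\<in>M. g i q) = (\<Sum>i\<in>K. g i q)"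
      by (intro sum.mono_neutral_left K \<open>M \<subseteq> K\<close>) simp
  qed
  finally show ?thesis .
qed

lemma op_pow_Z: "op_pow (pauli no_qubit g) k = pauli no_qubit (\<lambda>q. k * g q)"
  by (cases k) (simp_all add: op_pow_def id_eq_pauli)

section \<open>Local operators are spanned by Pauli operators\<close>

lemma supported_on_mono: "supported_on S T \<Longrightarrow> S \<subseteq> S' \<Longrightarrow> supported_on S' T"
  unfolding supported_on_def by blast

text \<open>
  The matrix on the larger set is the tensor product of \<open>m\<close> with the identity on \<open>F' - F\<close>. It makes
  two local operators comparable on the union of their supports.
\<close>

lemma supported_on_larger:
  assumes "finite F'" "F \<subseteq> F'"
  shows "\<exists>m'. (\<lambda>\<psi> \<sigma>. \<Sum>\<tau>\<in>Pow F. m (\<sigma> \<inter> F) \<tau> * \<psi> ((\<sigma> - F) \<union> \<tau>)) =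
    (\<lambda>\<psi> \<sigma>. \<Sum>\<tau>\<in>Pow F'. m' (\<sigma> \<inter> F') \<tau> * (\<psi> ((\<sigma> - F') \<union> \<tau>) :: complex))"
proof (intro exI ext)
  let ?m' = "\<lambda>\<rho> \<tau>. if \<tau> - F = \<rho> - F then m (\<rho> \<inter> F) (\<tau> \<inter> F) else 0"
  fix \<psi> and \<sigma> :: "'a set"
  let ?R = "\<sigma> \<inter> F' - F"
  have "(\<Sum>\<tau>\<in>Pow F'. ?m' (\<sigma> \<inter> F') \<tau> * \<psi> ((\<sigma> - F') \<union> \<tau>)) =
    (\<Sum>\<tau>\<in>{\<tau> \<in> Pow F'. \<tau> - F = ?R}. m (\<sigma> \<inter> F) (\<tau> \<inter> F) * \<psi> ((\<sigma> - F') \<union> \<tau>))"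
    using assms by (intro sum.mono_neutral_cong_right) (auto simp: Int_absorb1 Int_assoc)
  also have "\<dots> = (\<Sum>\<tau>\<in>Pow F. m (\<sigma> \<inter> F) \<tau> * \<psi> ((\<sigma> - F) \<union> \<tau>))"
  proof (rule sum.reindex_bij_witness[of _ "\<lambda>\<tau>. \<tau> \<union> ?R" "\<lambda>\<tau>. \<tau> \<inter> F"])
    fix \<tau> assume "\<tau> \<in> {\<tau> \<in> Pow F'. \<tau> - F = ?R}"
    hence "\<sigma> - F \<union> \<tau> \<inter> F = \<sigma> - F' \<union> \<tau>" using assms(2) by blast
    thus "m (\<sigma> \<inter> F) (\<tau> \<inter> F) * \<psi> (\<sigma> - F \<union> \<tau> \<inter> F) = m (\<sigma> \<inter> F) (\<tau> \<inter> F) * \<psi> (\<sigma> - F' \<union> \<tau>)"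
      by simp
  qed (use assms in auto)
  finally show "(\<Sum>\<tau>\<in>Pow F. m (\<sigma> \<inter> F) \<tau> * \<psi> ((\<sigma> - F) \<union> \<tau>)) =
    (\<Sum>\<tau>\<in>Pow F'. ?m' (\<sigma> \<inter> F') \<tau> * \<psi> ((\<sigma> - F') \<union> \<tau>))" by simp
qed

lemma supported_on_add:
  assumes "supported_on S T" "supported_on S T'"
  shows "supported_on S (add_op T T')"
proof -
  obtain F m where F: "finite F" "F \<subseteq> S"
    and T: "T = (\<lambda>\<psi> \<sigma>. \<Sum>\<tau>\<in>Pow F. m (\<sigma> \<inter> F) \<tau> * \<psi> ((\<sigma> - F) \<union> \<tau>))"
    using assms(1) unfolding supported_on_def by blast
  obtain F' m' where F': "finite F'" "F' \<subseteq> S"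
    and T': "T' = (\<lambda>\<psi> \<sigma>. \<Sum>\<tau>\<in>Pow F'. m' (\<sigma> \<inter> F') \<tau> * \<psi> ((\<sigma> - F') \<union> \<tau>))"
    using assms(2) unfolding supported_on_def by blast
  let ?F = "F \<union> F'"
  obtain n where n: "T = (\<lambda>\<psi> \<sigma>. \<Sum>\<tau>\<in>Pow ?F. n (\<sigma> \<inter> ?F) \<tau> * \<psi> ((\<sigma> - ?F) \<union> \<tau>))"
    using supported_on_larger[of ?F F m] F F' T by auto
  obtain n' where n': "T' = (\<lambda>\<psi> \<sigma>. \<Sum>\<tau>\<in>Pow ?F. n' (\<sigma> \<inter> ?F) \<tau> * \<psi> ((\<sigma> - ?F) \<union> \<tau>))"
    using supported_on_larger[of ?F F' m'] F F' T' by auto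
  have "add_op T T' =
    (\<lambda>\<psi> \<sigma>. \<Sum>\<tau>\<in>Pow ?F. (n (\<sigma> \<inter> ?F) \<tau> + n' (\<sigma> \<inter> ?F) \<tau>) * \<psi> ((\<sigma> - ?F) \<union> \<tau>))"
    unfolding n n' add_op_def by (simp add: sum.distrib distrib_right)
  thus ?thesis unfolding supported_on_def
    by (intro exI[of _ ?F] exI[of _ "\<lambda>\<rho> \<tau>. n \<rho> \<tau> + n' \<rho> \<tau>"]) (use F F' in auto)
qed

lemma supported_on_scale:
  assumes "supported_on S T"
  shows "supported_on S (scale_op z T)"
proof -
  obtain F m where F: "finite F" "F \<subseteq> S"
    and T: "T = (\<lambda>\<psi> \<sigma>. \<Sum>\<tau>\<in>Pow F. m (\<sigma> \<inter> F) \<tau> * \<psi> ((\<sigma> - F) \<union> \<tau>))"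
    using assms(1) unfolding supported_on_def by blast
  show ?thesis unfolding supported_on_def
    by (intro exI[of _ F] exI[of _ "\<lambda>\<rho> \<tau>. z * m \<rho> \<tau>"])
      (use F in \<open>auto simp: T scale_op_def sum_distrib_left mult.assoc\<close>)
qed

lemma supported_on_linear:
  assumes "supported_on S T"
  shows "T \<circ> add_op U V = add_op (T \<circ> U) (T \<circ> V)" "T \<circ> scale_op z U = scale_op z (T \<circ> U)"
proof -
  obtain F m where
    T: "T = (\<lambda>\<psi> \<sigma>. \<Sum>\<tau>\<in>Pow F. m (\<sigma> \<inter> F) \<tau> * \<psi> ((\<sigma> - F) \<union> \<tau>))"
    using assms(1) unfolding supported_on_def by blast
  show "T \<circ> add_op U V = add_op (T \<circ> U) (T \<circ> V)"
    by (simp add: T add_op_def fun_eq_iff sum.distrib distrib_left)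
  show "T \<circ> scale_op z U = scale_op z (T \<circ> U)"
    by (simp add: T scale_op_def fun_eq_iff sum_distrib_left algebra_simps)
qed

lemma supported_on_pauli:
  assumes "finite (supp f)" "finite (supp g)" "supp f \<subseteq> S" "supp g \<subseteq> S"
  shows "supported_on S (pauli f g)"
proof -
  let ?F = "supp f \<union> supp g"
  let ?m = "\<lambda>\<rho> \<tau>. if \<tau> = flip f \<rho> then bit_sign (pairing g (chi \<tau>)) else 0"
  have "pauli f g \<psi> \<sigma> = (\<Sum>\<tau>\<in>Pow ?F. ?m (\<sigma> \<inter> ?F) \<tau> * \<psi> ((\<sigma> - ?F) \<union> \<tau>))" for \<psi> \<sigma>
  proof -
    have in_F: "flip f (\<sigma> \<inter> ?F) \<in> Pow ?F" by (auto simp: flip_def supp_def)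
    have split: "\<sigma> - ?F \<union> flip f (\<sigma> \<inter> ?F) = flip f \<sigma>" by (auto simp: flip_def supp_def)
    have "pairing g (chi (flip f (\<sigma> \<inter> ?F))) = pairing g (chi (flip f \<sigma>))"
      unfolding pairing_def by (intro sum.cong) (auto simp: chi_def flip_def)
    moreover have "(\<Sum>\<tau>\<in>Pow ?F. ?m (\<sigma> \<inter> ?F) \<tau> * \<psi> ((\<sigma> - ?F) \<union> \<tau>)) =
      (\<Sum>\<tau>\<in>{flip f (\<sigma> \<inter> ?F)}. ?m (\<sigma> \<inter> ?F) \<tau> * \<psi> ((\<sigma> - ?F) \<union> \<tau>))"
      using assms in_F by (intro sum.mono_neutral_right) auto
    ultimately show ?thesis by (simp add: split pauli_def)
  qed
  hence "pauli f g = (\<lambda>\<psi> \<sigma>. \<Sum>\<tau>\<in>Pow ?F. ?m (\<sigma> \<inter> ?F) \<tau> * \<psi> ((\<sigma> - ?F) \<union> \<tau>))"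
    by blast
  thus ?thesis unfolding supported_on_def using assms by (intro exI[of _ ?F] exI[of _ ?m]) auto
qed

inductive pauli_span :: "'q set \<Rightarrow> 'q operator \<Rightarrow> bool" for S where
  pauli: "finite (supp f) \<Longrightarrow> finite (supp g) \<Longrightarrow> supp f \<subseteq> S \<Longrightarrow> supp g \<subseteq> S \<Longrightarrow>
    pauli_span S (pauli f g)"
| add: "pauli_span S T \<Longrightarrow> pauli_span S U \<Longrightarrow> pauli_span S (add_op T U)"
| scale: "pauli_span S T \<Longrightarrow> pauli_span S (scale_op z T)"

lemma pauli_span_imp_supported_on: "pauli_span S T \<Longrightarrow> supported_on S T"
  by (induction rule: pauli_span.induct)
    (simp_all add: supported_on_pauli supported_on_add supported_on_scale)

lemma pauli_span_comp:
  assumes "pauli_span S T" "pauli_span S U"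
  shows "pauli_span S (T \<circ> U)"
  using assms
proof (induction arbitrary: U rule: pauli_span.induct)
  case (pauli f g)
  note lin = supported_on_linear[OF supported_on_pauli[OF pauli.hyps]]
  show ?case using pauli.prems
  proof (induction rule: pauli_span.induct)
    case (pauli f' g')
    have "supp (\<lambda>q. f q + f' q) \<subseteq> S" "supp (\<lambda>q. g q + g' q) \<subseteq> S"
      using supp_add[of f f'] supp_add[of g g'] pauli \<open>supp f \<subseteq> S\<close> \<open>supp g \<subseteq> S\<close> by auto
    thus ?case
      using pauli \<open>finite (supp f)\<close> \<open>finite (supp g)\<close>
      by (auto simp: pauli_comp intro!: pauli_span.intros finite_supp_add)
  next
    case (add T U)
    thus ?case unfolding lin by (intro pauli_span.add)
  next
    case (scale T z)
    thus ?case unfolding lin by (intro pauli_span.scale)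
  qed
next
  case (add T T')
  have "add_op T T' \<circ> U = add_op (T \<circ> U) (T' \<circ> U)" by (simp add: add_op_def fun_eq_iff)
  thus ?case using add.IH add.prems pauli_span.add by metis
next
  case (scale T z)
  have "scale_op z T \<circ> U = scale_op z (T \<circ> U)" by (simp add: scale_op_def fun_eq_iff)
  thus ?case using scale.IH scale.prems pauli_span.scale by metis
qed

lemma pauli_span_id: "pauli_span S id"
  unfolding id_eq_pauli by (rule pauli_span.pauli) simp_all

lemma pauli_span_zero: "pauli_span S (\<lambda>\<psi> \<sigma>. 0)"
  using pauli_span.scale[OF pauli_span_id, of S 0] by (simp add: scale_op_def)

lemma pauli_span_sum:
  assumes "finite I" "\<And>i. i \<in> I \<Longrightarrow> pauli_span S (T i)"
  shows "pauli_span S (\<lambda>\<psi> \<sigma>. \<Sum>i\<in>I. T i \<psi> \<sigma>)"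
  using assms
proof (induction I)
  case empty
  show ?case by (simp add: pauli_span_zero)
next
  case (insert i I)
  have "(\<lambda>\<psi> \<sigma>. \<Sum>i\<in>insert i I. T i \<psi> \<sigma>) = add_op (T i) (\<lambda>\<psi> \<sigma>. \<Sum>i\<in>I. T i \<psi> \<sigma>)"
    using insert by (simp add: add_op_def)
  thus ?case using insert by (simp add: pauli_span.add)
qed

text \<open>
  The projector onto the configurations that agree with \<open>\<rho>\<close> on \<open>F\<close> is the product over \<open>q \<in> F\<close> of
  \<open>(1 \<plusminus> Z\<^sub>q) / 2\<close>.
\<close>

lemma pauli_span_projector:
  assumes "finite F" "F \<subseteq> S" "\<rho> \<subseteq> F"
  shows "pauli_span S (\<lambda>\<psi> \<sigma>. of_bool (\<sigma> \<inter> F = \<rho>) * \<psi> \<sigma>)"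
  using assms
proof (induction F arbitrary: \<rho>)
  case empty
  have "(\<lambda>\<psi> \<sigma>. of_bool (\<sigma> \<inter> {} = \<rho>) * \<psi> \<sigma>) = (id :: 'a operator)"
    using empty by (simp add: fun_eq_iff)
  thus ?case using pauli_span_id[of S] by (simp only:)
next
  case (insert q F)
  let ?s = "if q \<in> \<rho> then - 1 else 1 :: complex"
  let ?half = "scale_op (1/2) (add_op id (scale_op ?s (pauli_Z q)))"
  let ?P = "\<lambda>\<psi> \<sigma>. of_bool (\<sigma> \<inter> F = \<rho> - {q}) * \<psi> \<sigma> :: complex"
  have half: "?half \<psi> \<sigma> = of_bool (q \<in> \<sigma> \<longleftrightarrow> q \<in> \<rho>) * \<psi> \<sigma>" for \<psi> \<sigma>
    by (simp add: scale_op_def add_op_def pauli_Z_def)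
  have "\<sigma> \<inter> insert q F = \<rho> \<longleftrightarrow> \<sigma> \<inter> F = \<rho> - {q} \<and> (q \<in> \<sigma> \<longleftrightarrow> q \<in> \<rho>)" for \<sigma>
    using insert by auto
  hence "(\<lambda>\<psi> \<sigma>. of_bool (\<sigma> \<inter> insert q F = \<rho>) * \<psi> \<sigma>) = ?P \<circ> ?half"
    by (intro ext) (simp add: half)
  moreover have "pauli_span S ?P" using insert by (intro insert.IH) auto
  moreover have "pauli_span S ?half" unfolding pauli_Z_eq
    using insert by (intro pauli_span.intros pauli_span_id) auto
  ultimately show ?case using pauli_span_comp by (simp only:)
qed

text \<open>
  A matrix unit from \<open>\<tau>\<close> to \<open>\<rho>\<close> is the projector onto \<open>\<rho>\<close> composed with the \<open>X\<close> operator that flips the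
  qubits where \<open>\<rho>\<close> and \<open>\<tau>\<close> differ.
\<close>

lemma supported_on_iff_pauli_span: "supported_on S T \<longleftrightarrow> pauli_span S T"
proof
  assume "supported_on S T"
  then obtain F m where F: "finite F" "F \<subseteq> S"
    and T: "T = (\<lambda>\<psi> \<sigma>. \<Sum>\<tau>\<in>Pow F. m (\<sigma> \<inter> F) \<tau> * \<psi> ((\<sigma> - F) \<union> \<tau>))"
    unfolding supported_on_def by blast
  let ?P = "\<lambda>\<rho> \<psi> \<sigma>. of_bool (\<sigma> \<inter> F = \<rho>) * \<psi> \<sigma> :: complex"
  let ?X = "\<lambda>\<rho> \<tau>. pauli (chi ((\<rho> - \<tau>) \<union> (\<tau> - \<rho>))) no_qubit"
  let ?E = "\<lambda>\<tau> \<rho>. scale_op (m \<rho> \<tau>) (?P \<rho> \<circ> ?X \<rho> \<tau>)"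
  have unit: "(?P \<rho> \<circ> ?X \<rho> \<tau>) \<psi> \<sigma> = of_bool (\<sigma> \<inter> F = \<rho>) * \<psi> ((\<sigma> - F) \<union> \<tau>)"
    if "\<tau> \<subseteq> F" for \<rho> \<tau> \<psi> \<sigma>
  proof (cases "\<sigma> \<inter> F = \<rho>")
    case True
    hence "flip (chi ((\<rho> - \<tau>) \<union> (\<tau> - \<rho>))) \<sigma> = (\<sigma> - F) \<union> \<tau>"
      using that by (auto simp: flip_def chi_def)
    thus ?thesis by (simp add: pauli_def)
  qed simp
  have "T = (\<lambda>\<psi> \<sigma>. \<Sum>\<tau>\<in>Pow F. \<Sum>\<rho>\<in>Pow F. ?E \<tau> \<rho> \<psi> \<sigma>)"
  proof (intro ext)
    fix \<psi> \<sigma>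
    have "(\<Sum>\<rho>\<in>Pow F. ?E \<tau> \<rho> \<psi> \<sigma>) = m (\<sigma> \<inter> F) \<tau> * \<psi> ((\<sigma> - F) \<union> \<tau>)" if "\<tau> \<in> Pow F" for \<tau>
    proof -
      have "(\<Sum>\<rho>\<in>Pow F. ?E \<tau> \<rho> \<psi> \<sigma>) = (\<Sum>\<rho>\<in>{\<sigma> \<inter> F}. ?E \<tau> \<rho> \<psi> \<sigma>)"
        using F that unfolding scale_op_def by (intro sum.mono_neutral_right) auto
      also have "\<dots> = m (\<sigma> \<inter> F) \<tau> * \<psi> ((\<sigma> - F) \<union> \<tau>)"
        using that unit[of \<tau>] by (simp add: scale_op_def del: o_apply)
      finally show ?thesis .
    qed
    thus "T \<psi> \<sigma> = (\<Sum>\<tau>\<in>Pow F. \<Sum>\<rho>\<in>Pow F. ?E \<tau> \<rho> \<psi> \<sigma>)"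
      unfolding T by (intro sum.cong) auto
  qed
  moreover have "pauli_span S (?E \<tau> \<rho>)" if "\<rho> \<in> Pow F" "\<tau> \<in> Pow F" for \<rho> \<tau>
    using F that
    by (intro pauli_span.scale pauli_span_comp pauli_span_projector pauli_span.pauli)
      (auto intro: finite_subset[of _ F])
  ultimately show "pauli_span S T"
    using F(1) by (auto intro!: pauli_span_sum)
qed (rule pauli_span_imp_supported_on)

lemma supported_on_comp: "supported_on S T \<Longrightarrow> supported_on S U \<Longrightarrow> supported_on S (T \<circ> U)"
  by (simp add: supported_on_iff_pauli_span pauli_span_comp)

lemma supported_on_id: "supported_on S id"
  by (simp add: supported_on_iff_pauli_span pauli_span_id)

lemma subalgebra_local_operators: "subalgebra Q (local_operators Q)"
  by (simp add: subalgebra_def local_operators_def supported_on_comp supported_on_id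
      supported_on_add supported_on_scale)

lemma subalgebra_hull:
  assumes "G \<subseteq> local_operators Q"
  shows "subalgebra Q (subalgebra Q hull G)"
proof -
  have "subalgebra Q hull G \<subseteq> local_operators Q"
    using assms subalgebra_local_operators by (rule hull_minimal)
  thus ?thesis unfolding subalgebra_def hull_def by blast
qed

lemma subalgebra_commuting:
  assumes "B \<in> local_operators Q"
  shows "subalgebra Q {S \<in> local_operators Q. S \<circ> B = B \<circ> S}"
proof -
  have B: "supported_on Q B" using assms by (simp add: local_operators_def)
  have add: "add_op S T \<circ> B = B \<circ> add_op S T" if "S \<circ> B = B \<circ> S" "T \<circ> B = B \<circ> T" for S T
    unfolding supported_on_linear[OF B] by (simp flip: that) (simp add: add_op_def fun_eq_iff)
  have scale: "scale_op z S \<circ> B = B \<circ> scale_op z S" if "S \<circ> B = B \<circ> S" for S z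
    unfolding supported_on_linear[OF B] by (simp flip: that) (simp add: scale_op_def fun_eq_iff)
  have comp: "(S \<circ> T) \<circ> B = B \<circ> (S \<circ> T)" if "S \<circ> B = B \<circ> S" "T \<circ> B = B \<circ> T" for S T
    using that by (metis comp_assoc)
  show ?thesis
    using subalgebra_local_operators[of Q] add scale comp
    by (auto simp: subalgebra_def simp del: o_apply)
qed

section \<open>Generation up to a phase, and a criterion for invertibility\<close>

definition phase_product :: "'q operator set \<Rightarrow> 'q operator \<Rightarrow> bool" where
  "phase_product G T \<longleftrightarrow>
     (\<exists>z Ts. norm z = 1 \<and> set Ts \<subseteq> G \<and> T = scale_op z (foldr (\<circ>) Ts id))"

definition generated :: "'q operator set \<Rightarrow> ('q \<Rightarrow> bit) \<Rightarrow> ('q \<Rightarrow> bit) \<Rightarrow> bool" where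
  "generated G f g \<longleftrightarrow> finite (supp f) \<and> finite (supp g) \<and> phase_product G (pauli f g)"

lemma scale_op_1 [simp]: "scale_op 1 T = T"
  by (simp add: scale_op_def)

lemma scale_op_scale_op: "scale_op z (scale_op w T) = scale_op (z * w) T"
  by (simp add: scale_op_def mult.assoc)

lemma scale_op_comp_left: "scale_op z T \<circ> U = scale_op z (T \<circ> U)"
  by (simp add: scale_op_def fun_eq_iff)

lemma phase_product_mono: "phase_product G T \<Longrightarrow> G \<subseteq> G' \<Longrightarrow> phase_product G' T"
  unfolding phase_product_def by blast

lemma phase_product_scale:
  assumes "phase_product G T" "norm z = 1"
  shows "phase_product G (scale_op z T)"
proof -
  obtain w Ts where "norm w = 1" "set Ts \<subseteq> G" "T = scale_op w (foldr (\<circ>) Ts id)"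
    using assms(1) unfolding phase_product_def by blast
  thus ?thesis unfolding phase_product_def using assms(2)
    by (intro exI[of _ "z * w"] exI[of _ Ts]) (simp add: scale_op_scale_op norm_mult)
qed

lemma phase_product_id: "phase_product G id"
  unfolding phase_product_def by (intro exI[of _ 1] exI[of _ "[]"]) simp

lemma phase_product_base: "T \<in> G \<Longrightarrow> phase_product G T"
  unfolding phase_product_def by (intro exI[of _ 1] exI[of _ "[T]"]) simp

lemma foldr_comp_append: "foldr (\<circ>) (Ts @ Us) id = foldr (\<circ>) Ts id \<circ> foldr (\<circ>) Us id"
  by (induction Ts) (simp_all add: comp_assoc)

lemma supported_on_foldr:
  "(\<And>T. T \<in> set Ts \<Longrightarrow> supported_on S T) \<Longrightarrow> supported_on S (foldr (\<circ>) Ts id)"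
  by (induction Ts) (simp_all add: supported_on_id supported_on_comp)

lemma phase_product_comp:
  assumes G: "G \<subseteq> local_operators Q" and "phase_product G T" "phase_product G U"
  shows "phase_product G (T \<circ> U)"
proof -
  obtain z Ts where T: "norm z = 1" "set Ts \<subseteq> G" "T = scale_op z (foldr (\<circ>) Ts id)"
    using assms(2) unfolding phase_product_def by blast
  obtain w Us where U: "norm w = 1" "set Us \<subseteq> G" "U = scale_op w (foldr (\<circ>) Us id)"
    using assms(3) unfolding phase_product_def by blast
  have "supported_on Q (foldr (\<circ>) Ts id)"
    using T(2) G by (intro supported_on_foldr) (auto simp: local_operators_def)
  hence "T \<circ> U = scale_op (z * w) (foldr (\<circ>) (Ts @ Us) id)"
    unfolding T(3) U(3)
    by (simp only: scale_op_comp_left supported_on_linear scale_op_scale_op foldr_comp_append)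
  thus ?thesis unfolding phase_product_def using T U
    by (intro exI[of _ "z * w"] exI[of _ "Ts @ Us"]) (simp add: norm_mult)
qed

lemma generated_mono: "generated G f g \<Longrightarrow> G \<subseteq> G' \<Longrightarrow> generated G' f g"
  unfolding generated_def using phase_product_mono by blast

lemma generated_zero: "generated G no_qubit no_qubit"
  by (simp add: generated_def phase_product_id flip: id_eq_pauli)

text \<open>
  The sign that arises when two Pauli operators are multiplied is absorbed in the phase, so the
  generated vectors are closed under addition.
\<close>

lemma generated_add:
  assumes G: "G \<subseteq> local_operators Q" and fg: "generated G f g" "generated G f' g'"
  shows "generated G (\<lambda>q. f q + f' q) (\<lambda>q. g q + g' q)"
proof -
  let ?s = "bit_sign (pairing g f')"
  let ?P = "pauli (\<lambda>q. f q + f' q) (\<lambda>q. g q + g' q)"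
  have "phase_product G (pauli f g \<circ> pauli f' g')"
    using fg by (intro phase_product_comp[OF G]) (simp_all add: generated_def)
  hence "phase_product G (scale_op ?s ?P)"
    using fg by (simp add: generated_def pauli_comp)
  hence "phase_product G (scale_op ?s (scale_op ?s ?P))"
    by (rule phase_product_scale) simp
  hence "phase_product G ?P" by (simp add: scale_op_scale_op)
  thus ?thesis using fg by (simp add: generated_def finite_supp_add)
qed

lemma generated_sum:
  assumes G: "G \<subseteq> local_operators Q" and "finite I" "\<And>i. i \<in> I \<Longrightarrow> generated G (f i) (g i)"
  shows "generated G (\<lambda>q. \<Sum>i\<in>I. f i q) (\<lambda>q. \<Sum>i\<in>I. g i q)"
  using assms(2,3)
proof (induction I)
  case (insert i I)
  have "generated G (\<lambda>q. f i q + (\<Sum>i\<in>I. f i q)) (\<lambda>q. g i q + (\<Sum>i\<in>I. g i q))"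
    using insert by (intro generated_add[OF G]) auto
  thus ?case using insert by simp
qed (simp add: generated_zero)

lemma sum_single_supp:
  assumes "finite (supp g)"
  shows "(\<lambda>q. \<Sum>p\<in>supp g. single p q) = g"
proof
  fix q
  have "(\<Sum>p\<in>supp g. single p q) = (\<Sum>p\<in>supp g. if q = p then 1 else 0)"
    by (simp add: single_def of_bool_def)
  also have "\<dots> = g q" using assms by (cases "g q") (auto simp: supp_def)
  finally show "(\<Sum>p\<in>supp g. single p q) = g q" .
qed

lemma generated_Z_part:
  assumes "G \<subseteq> local_operators Q" "finite (supp g)"
    and "\<And>q. q \<in> supp g \<Longrightarrow> generated G no_qubit (single q)"
  shows "generated G no_qubit g"
  using generated_sum[OF assms(1) assms(2), of "\<lambda>_. no_qubit" single] assms(3)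
  by (simp add: sum_single_supp assms(2))

lemma generated_X_part:
  assumes "G \<subseteq> local_operators Q" "finite (supp f)"
    and "\<And>q. q \<in> supp f \<Longrightarrow> generated G (single q) no_qubit"
  shows "generated G f no_qubit"
  using generated_sum[OF assms(1) assms(2), of single "\<lambda>_. no_qubit"] assms(3)
  by (simp add: sum_single_supp assms(2))

text \<open>
  An operator supported on \<open>S\<close> is a combination of Pauli operators on \<open>S\<close>, each of which is a product of members
  of \<open>A\<close> and \<open>B\<close> near \<open>S\<close>. As \<open>A\<close> commutes with \<open>B\<close>, the members of \<open>A\<close> can be moved to the left; the
  remaining factor lies in the commutant.
\<close>

lemma invertible_subalgebra_hull:
  assumes A: "A \<subseteq> local_operators Q" and B: "B \<subseteq> local_operators Q"
    and AB: "\<And>S T. S \<in> A \<Longrightarrow> T \<in> B \<Longrightarrow> S \<circ> T = T \<circ> S"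
    and gen: "\<And>q P. q \<in> Q \<Longrightarrow> P \<in> {pauli_X q, pauli_Z q} \<Longrightarrow>
      phase_product {T \<in> A \<union> B. supported_on (neighbourhood Q D r {q}) T} P"
  shows "invertible_subalgebra Q D (subalgebra Q hull A)"
proof -
  define H where "H = subalgebra Q hull A"
  have H: "subalgebra Q H" unfolding H_def using A by (rule subalgebra_hull)
  have commutant_comp: "b \<circ> b' \<in> commutant Q H"
    if "b \<in> commutant Q H" "b' \<in> commutant Q H" for b b'
  proof -
    have "S \<circ> (b \<circ> b') = (b \<circ> b') \<circ> S" if "S \<in> H" for S
    proof -
      have "S \<circ> b = b \<circ> S" "S \<circ> b' = b' \<circ> S"
        using that \<open>b \<in> commutant Q H\<close> \<open>b' \<in> commutant Q H\<close> by (auto simp: commutant_def)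
      thus ?thesis by (metis comp_assoc)
    qed
    moreover have "supported_on Q (b \<circ> b')"
      using that by (intro supported_on_comp) (simp_all add: commutant_def local_operators_def)
    ultimately show ?thesis
      unfolding commutant_def local_operators_def by blast
  qed
  have commutant_id: "id \<in> commutant Q H"
    by (simp add: commutant_def local_operators_def supported_on_id)
  have B_commutant: "b \<in> commutant Q H" if "b \<in> B" for b
  proof -
    have "H \<subseteq> {S \<in> local_operators Q. S \<circ> b = b \<circ> S}"
      unfolding H_def using A AB that B by (intro hull_minimal subalgebra_commuting) auto
    thus ?thesis using B that by (auto simp: commutant_def)
  qed
  have split: "\<exists>n a b. (\<forall>i<(n::nat). a i \<in> H \<and> supported_on (neighbourhood Q D r S) (a i) \<and>
        b i \<in> commutant Q H \<and> supported_on (neighbourhood Q D r S) (b i)) \<and>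
        T = (\<lambda>\<psi> \<sigma>. \<Sum>i<n. (a i \<circ> b i) \<psi> \<sigma>)"
    if S: "S \<subseteq> Q" and T: "supported_on S T" for S T
  proof -
    define N where "N = neighbourhood Q D r S"
    define splits where "splits a b \<longleftrightarrow>
      a \<in> H \<and> supported_on N a \<and> b \<in> commutant Q H \<and> supported_on N b" for a b
    define G where "G = {T \<in> A \<union> B. supported_on N T}"
    have G: "G \<subseteq> local_operators Q" using A B by (auto simp: G_def)
    have "neighbourhood Q D r {q} \<subseteq> N" if "q \<in> S" for q
      using that by (auto simp: N_def neighbourhood_def)
    hence "{T \<in> A \<union> B. supported_on (neighbourhood Q D r {q}) T} \<subseteq> G" if "q \<in> S" for q
      using that by (auto simp: G_def intro: supported_on_mono)
    hence G_single: "phase_product G P" if "q \<in> S" "P \<in> {pauli_X q, pauli_Z q}" for q P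
      using that S gen phase_product_mono by (metis (no_types, lifting) subsetD)
    have splits_comp: "\<exists>a'' b''. splits a'' b'' \<and> (a \<circ> b) \<circ> (a' \<circ> b') = a'' \<circ> b''"
      if "splits a b" "splits a' b'" for a b a' b'
    proof (intro exI conjI)
      show "splits (a \<circ> a') (b \<circ> b')"
        using that H unfolding splits_def
        by (simp add: subalgebra_def supported_on_comp commutant_comp)
      have "a' \<circ> b = b \<circ> a'" using that by (simp add: splits_def commutant_def)
      thus "(a \<circ> b) \<circ> (a' \<circ> b') = (a \<circ> a') \<circ> (b \<circ> b')" by (metis comp_assoc)
    qed
    have splits_G: "\<exists>a b. splits a b \<and> T = a \<circ> b" if "T \<in> G" for T
    proof (cases "T \<in> A")
      case True
      hence "T \<in> H" by (simp add: H_def hull_inc)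
      hence "splits T id" using that
        by (auto simp: splits_def G_def commutant_id supported_on_id)
      thus ?thesis by (metis comp_id)
    next
      case False
      hence "splits id T" using that H
        by (auto simp: splits_def G_def supported_on_id B_commutant subalgebra_def)
      thus ?thesis by (metis id_comp)
    qed
    have splits_id: "splits id id"
      using H by (simp add: splits_def commutant_id supported_on_id subalgebra_def)
    have splits_foldr: "\<exists>a b. splits a b \<and> foldr (\<circ>) Ts id = a \<circ> b" if "set Ts \<subseteq> G" for Ts
      using that
    proof (induction Ts)
      case Nil
      show ?case using splits_id by (metis comp_id foldr_Nil id_apply)
    next
      case (Cons T Ts)
      obtain a b a' b' where *: "splits a b" "T = a \<circ> b" "splits a' b'" "foldr (\<circ>) Ts id = a' \<circ> b'"
        using Cons.IH Cons.prems splits_G[of T] by (metis insert_subset list.simps(15))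
      have "foldr (\<circ>) (T # Ts) id = (a \<circ> b) \<circ> (a' \<circ> b')"
        unfolding *(2)[symmetric] *(4)[symmetric] by simp
      thus ?case using splits_comp[OF *(1,3)] by (simp only:)
    qed
    have splits_scale: "splits (scale_op z a) b" if "splits a b" for z a b
      using that H by (simp add: splits_def subalgebra_def supported_on_scale)
    have splits_pauli: "\<exists>a b. splits a b \<and> pauli f g = a \<circ> b"
      if "finite (supp f)" "finite (supp g)" "supp f \<subseteq> S" "supp g \<subseteq> S" for f g
    proof -
      have single: "generated G (single q) no_qubit" "generated G no_qubit (single q)" if "q \<in> S" for q
        using G_single[OF that, of "pauli_X q"] G_single[OF that, of "pauli_Z q"]
        by (simp_all add: generated_def pauli_X_eq pauli_Z_eq)
      have "generated G f no_qubit"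
        using that(1) by (rule generated_X_part[OF G]) (rule single(1), rule subsetD[OF that(3)])
      moreover have "generated G no_qubit g"
        using that(2) by (rule generated_Z_part[OF G]) (rule single(2), rule subsetD[OF that(4)])
      ultimately have "generated G (\<lambda>q. f q + 0) (\<lambda>q. 0 + g q)"
        by (rule generated_add[OF G])
      hence "generated G f g" by simp
      then obtain z Ts where "set Ts \<subseteq> G" "pauli f g = scale_op z (foldr (\<circ>) Ts id)"
        unfolding generated_def phase_product_def by blast
      thus ?thesis using splits_foldr[of Ts] splits_scale by (metis scale_op_comp_left)
    qed
    have "pauli_span S T" using T by (simp add: supported_on_iff_pauli_span)
    hence "\<exists>ps. (\<forall>(a, b)\<in>set ps. splits a b) \<and>
      T = (\<lambda>\<psi> \<sigma>. \<Sum>(a, b)\<leftarrow>ps. (a \<circ> b) \<psi> \<sigma>)"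
    proof (induction rule: pauli_span.induct)
      case (pauli f g)
      then obtain a b where "splits a b" "pauli f g = a \<circ> b" using splits_pauli by blast
      thus ?case by (intro exI[of _ "[(a, b)]"]) simp
    next
      case (add T U)
      then obtain ps qs where
        "\<forall>(a, b)\<in>set ps. splits a b" "T = (\<lambda>\<psi> \<sigma>. \<Sum>(a, b)\<leftarrow>ps. (a \<circ> b) \<psi> \<sigma>)"
        "\<forall>(a, b)\<in>set qs. splits a b" "U = (\<lambda>\<psi> \<sigma>. \<Sum>(a, b)\<leftarrow>qs. (a \<circ> b) \<psi> \<sigma>)"
        by blast
      thus ?case by (intro exI[of _ "ps @ qs"]) (auto simp: add_op_def)
    next
      case (scale T z)
      then obtain ps where
        ps: "\<forall>(a, b)\<in>set ps. splits a b" "T = (\<lambda>\<psi> \<sigma>. \<Sum>(a, b)\<leftarrow>ps. (a \<circ> b) \<psi> \<sigma>)"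
        by blast
      show ?case
      proof (intro exI[of _ "map (\<lambda>(a, b). (scale_op z a, b)) ps"] conjI)
        show "\<forall>(a, b)\<in>set (map (\<lambda>(a, b). (scale_op z a, b)) ps). splits a b"
          using ps(1) splits_scale by auto
        show "scale_op z T = (\<lambda>\<psi> \<sigma>. \<Sum>(a, b)\<leftarrow>map (\<lambda>(a, b). (scale_op z a, b)) ps. (a \<circ> b) \<psi> \<sigma>)"
          unfolding ps(2) scale_op_def
          by (auto simp: fun_eq_iff sum_list_const_mult[symmetric] case_prod_beta
              intro!: arg_cong[where f = sum_list])
      qed
    qed
    then obtain ps where ps: "\<forall>(a, b)\<in>set ps. splits a b"
      "T = (\<lambda>\<psi> \<sigma>. \<Sum>(a, b)\<leftarrow>ps. (a \<circ> b) \<psi> \<sigma>)" by blast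
    have "\<forall>i<length ps. splits (fst (ps ! i)) (snd (ps ! i))"
      using ps(1) nth_mem by fastforce
    moreover have "T = (\<lambda>\<psi> \<sigma>. \<Sum>i<length ps. (fst (ps ! i) \<circ> snd (ps ! i)) \<psi> \<sigma>)"
      unfolding ps(2) by (simp add: sum_list_sum_nth atLeast0LessThan case_prod_beta)
    ultimately show ?thesis unfolding splits_def N_def
      by (intro exI[of _ "length ps"] exI[of _ "\<lambda>i. fst (ps ! i)"] exI[of _ "\<lambda>i. snd (ps ! i)"]) auto
  qed
  show ?thesis unfolding invertible_subalgebra_def H_def[symmetric]
    using H split by blast
qed

section \<open>Cup products of single cells\<close>

definition unshift :: "vertex \<Rightarrow> nat set \<Rightarrow> vertex" where
  "unshift v I = (\<lambda>i. v i - of_bool (i \<in> I))"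

text \<open>
  The integral of \<open>c \<union> c'\<close> is nonzero for exactly one \<open>c'\<close>, the cell \<open>cup_succ l c\<close>; the inverse map is
  \<open>cup_pred l\<close>.
\<close>

definition cup_succ :: "nat \<Rightarrow> cell \<Rightarrow> cell" where
  "cup_succ l = (\<lambda>(v, I). (shift v I, {1..2 * l} - I))"

definition cup_pred :: "nat \<Rightarrow> cell \<Rightarrow> cell" where
  "cup_pred l = (\<lambda>(w, J). (unshift w ({1..2 * l} - J), {1..2 * l} - J))"

text \<open>
  For an \<open>l\<close>-cell \<open>c\<close> the cells \<open>t\<close> with \<open>\<integral> t \<union>\<^sub>1 c \<noteq> 0\<close> are the \<open>cup1_pred l c k\<close>, and those with
  \<open>\<integral> c \<union>\<^sub>1 t \<noteq> 0\<close> are the \<open>cup1_succ l c k\<close>. In both cases \<open>k\<close> is the direction that \<open>c\<close> and \<open>t\<close> share.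
\<close>

definition cup1_pred :: "nat \<Rightarrow> cell \<Rightarrow> nat \<Rightarrow> cell" where
  "cup1_pred l = (\<lambda>(w, J) k.
     (shift (unshift w {i \<in> {1..2 * l} - J. i < k}) {j \<in> J. k < j}, insert k ({1..2 * l} - J)))"

definition cup1_succ :: "nat \<Rightarrow> cell \<Rightarrow> nat \<Rightarrow> cell" where
  "cup1_succ l = (\<lambda>(v, I) k.
     (shift (unshift v {j \<in> {1..2 * l} - I. k < j}) {i \<in> I. i < k}, insert k ({1..2 * l} - I)))"

text \<open>
  The coboundary of an indicator cochain at \<open>t\<close> is the incidence number of \<open>x\<close> in the boundary of \<open>t\<close>.
\<close>

abbreviation incidence :: "cell \<Rightarrow> cell \<Rightarrow> bit" where
  "incidence x t \<equiv> coboundary (indicator_cochain x) t"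

lemma incidence_eq: "incidence x (u, T) =
    (\<Sum>i\<in>T. of_bool (x = (u, T - {i})) + of_bool (x = (shift u {i}, T - {i})))"
  by (simp add: coboundary_def indicator_cochain_def eq_commute)

lemma shift_unshift: "shift (unshift v I) I = v" "unshift (shift v I) I = v"
  by (simp_all add: shift_def unshift_def)

lemma shift_eq_iff: "shift u A = w \<longleftrightarrow> u = unshift w A"
  using shift_unshift by metis

lemma shift_in_vertices: "v \<in> vertices d \<Longrightarrow> I \<subseteq> {1..d} \<Longrightarrow> shift v I \<in> vertices d"
  by (auto simp: vertices_def shift_def)

lemma unshift_in_vertices: "v \<in> vertices d \<Longrightarrow> I \<subseteq> {1..d} \<Longrightarrow> unshift v I \<in> vertices d"
  by (auto simp: vertices_def unshift_def)

lemma cells_top: "c \<in> cells d d \<longleftrightarrow> (\<exists>v\<in>vertices d. c = (v, {1..d}))"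
proof -
  have "I = {1..d}" if "I \<subseteq> {1..d}" "card I = d" for I
    using that by (intro card_subset_eq) auto
  moreover have "card {1..d} = d" by simp
  ultimately have "I \<subseteq> {1..d} \<and> card I = d \<longleftrightarrow> I = {1..d}" for I by blast
  thus ?thesis by (cases c) (simp add: cells_def Bex_def)
qed

lemma integral_eq_of_bool:
  assumes "v0 \<in> vertices d"
    and "\<And>v. v \<in> vertices d \<Longrightarrow> a (v, {1..d}) = of_bool (v = v0 \<and> P)"
  shows "integral d a = of_bool P"
proof -
  have "{c \<in> cells d d. a c \<noteq> 0} = (if P then {(v0, {1..d})} else {})"
    using assms by (auto simp: cells_top)
  thus ?thesis using assms by (simp add: integral_def)
qed

lemma int_cup_eq:
  assumes "c \<in> cells (2 * l) l"
  shows "int_cup l c c' = of_bool (c' = cup_succ l c)"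
proof -
  obtain v I where c: "c = (v, I)" by (cases c)
  have v: "v \<in> vertices (2 * l)" and I: "I \<subseteq> {1..2 * l}" "card I = l"
    using assms by (auto simp: c cells_def)
  show ?thesis unfolding int_cup_def
  proof (rule integral_eq_of_bool[OF v])
    fix u
    let ?S = "{(I, J). I \<union> J = {1..2 * l} \<and> I \<inter> J = {} \<and> card I = l}"
    let ?h = "\<lambda>(I, J). indicator_cochain c (u, I) * indicator_cochain c' (shift u I, J)"
    have "?S \<subseteq> Pow {1..2 * l} \<times> Pow {1..2 * l}" by auto
    hence "finite ?S" by (rule finite_subset) simp
    hence "sum ?h ?S = sum ?h {(I, {1..2 * l} - I)}"
      using I by (intro sum.mono_neutral_right) (auto simp: c indicator_cochain_def)
    thus "cup l (indicator_cochain c) (indicator_cochain c') (u, {1..2 * l}) =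
      of_bool (u = v \<and> c' = cup_succ l c)"
      by (auto simp: cup_def c indicator_cochain_def cup_succ_def)
  qed
qed

lemma cup1_pred_inj: "k \<in> snd c \<Longrightarrow> k' \<in> snd c \<Longrightarrow> cup1_pred l c k = cup1_pred l c k' \<Longrightarrow> k = k'"
  by (auto simp: cup1_pred_def split: prod.splits)

lemma cup1_succ_inj: "k \<in> snd c \<Longrightarrow> k' \<in> snd c \<Longrightarrow> cup1_succ l c k = cup1_succ l c k' \<Longrightarrow> k = k'"
  by (auto simp: cup1_succ_def split: prod.splits)

lemma sum_of_bool_unique:
  assumes "finite K" "\<And>k. k \<in> K \<Longrightarrow> P k \<Longrightarrow> k = k0" "k0 \<in> K"
  shows "(\<Sum>k\<in>K. of_bool (P k \<and> R k)) = (of_bool (P k0 \<and> R k0) :: bit)"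
proof -
  have "(\<Sum>k\<in>K. of_bool (P k \<and> R k)) = (\<Sum>k\<in>{k0}. of_bool (P k \<and> R k) :: bit)"
    using assms by (intro sum.mono_neutral_right) auto
  thus ?thesis by simp
qed

lemma finite_splittings: "finite K \<Longrightarrow> finite {(I, J). I \<union> J = K - {k} \<and> I \<inter> J = {} \<and> card I = p}"
  by (rule finite_subset[of _ "Pow K \<times> Pow K"]) auto

text \<open>
  For a fixed shared direction \<open>k\<close> the cell \<open>c\<close> determines the splitting of the other directions, the base
  vertex of the top cell and \<open>t\<close> itself; and \<open>t\<close> determines \<open>k\<close>. Hence at most one term of the integral is
  nonzero.
\<close>

lemma int_cup1_cell_right_eq:
  assumes "c \<in> cells (2 * l) l"
  shows "int_cup1_cell_right l t c = of_bool (t \<in> cup1_pred l c ` snd c)"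
proof -
  obtain w J where c: "c = (w, J)" by (cases c)
  let ?D = "{1..2 * l}"
  have w: "w \<in> vertices (2 * l)" and J: "J \<subseteq> ?D" "card J = l"
    using assms by (auto simp: c cells_def)
  have card: "card (?D - J) = l" using J by (simp add: card_Diff_subset finite_subset)
  define base where "base k = unshift w {i \<in> ?D - J. i < k}" for k
  have cup1_at: "cup1 (l + 1) (indicator_cochain t) (indicator_cochain c) (u, ?D) =
    (\<Sum>k\<in>J. of_bool (t = cup1_pred l c k \<and> u = base k))" for u
  proof -
    let ?S = "\<lambda>k. {(I, J). I \<union> J = ?D - {k} \<and> I \<inter> J = {} \<and> card I = l + 1 - 1}"
    let ?h = "\<lambda>k (I, J'). indicator_cochain t (shift u {j \<in> J'. k < j}, insert k I) *
      indicator_cochain c (shift u {i \<in> I. i < k}, insert k J')"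
    have inside: "sum (?h k) (?S k) = of_bool (t = cup1_pred l c k \<and> u = base k)" if "k \<in> J" for k
    proof -
      have "sum (?h k) (?S k) = sum (?h k) {(?D - J, J - {k})}"
        using J card that
        by (intro sum.mono_neutral_right finite_splittings) (auto simp: c indicator_cochain_def)
      moreover have "{j \<in> J - {k}. k < j} = {j \<in> J. k < j}" by auto
      ultimately show ?thesis using that
        by (auto simp: c indicator_cochain_def cup1_pred_def base_def shift_eq_iff insert_absorb)
    qed
    have outside: "sum (?h k) (?S k) = 0" if "k \<notin> J" for k
      using that by (intro sum.neutral) (auto simp: c indicator_cochain_def)
    have "(\<Sum>k\<in>?D. sum (?h k) (?S k)) = (\<Sum>k\<in>J. of_bool (t = cup1_pred l c k \<and> u = base k))"
      using J outside inside by (intro sum.mono_neutral_cong_right) auto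
    thus ?thesis by (simp add: cup1_def)
  qed
  have fin: "finite J" using J finite_subset by blast
  show ?thesis
  proof (cases "t \<in> cup1_pred l c ` snd c")
    case True
    then obtain k where k: "k \<in> J" "t = cup1_pred l c k" by (auto simp: c)
    have "integral (2 * l) (cup1 (l + 1) (indicator_cochain t) (indicator_cochain c)) = of_bool True"
    proof (rule integral_eq_of_bool)
      show "base k \<in> vertices (2 * l)"
        unfolding base_def by (intro unshift_in_vertices w) auto
      fix u
      show "cup1 (l + 1) (indicator_cochain t) (indicator_cochain c) (u, ?D) =
        of_bool (u = base k \<and> True)"
        unfolding cup1_at using k cup1_pred_inj[of _ c k l]
        by (subst sum_of_bool_unique[OF fin, of _ k]) (auto simp: c)
    qed
    thus ?thesis using True by (simp add: int_cup1_cell_right_def)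
  next
    case False
    have "integral (2 * l) (cup1 (l + 1) (indicator_cochain t) (indicator_cochain c)) = of_bool False"
      using False
      by (intro integral_eq_of_bool[OF w], unfold cup1_at) (auto simp: c intro!: sum.neutral)
    thus ?thesis using False by (simp add: int_cup1_cell_right_def)
  qed
qed

lemma int_cup1_cell_left_eq:
  assumes "c \<in> cells (2 * l) l"
  shows "int_cup1_cell_left l c t = of_bool (t \<in> cup1_succ l c ` snd c)"
proof -
  obtain v I where c: "c = (v, I)" by (cases c)
  let ?D = "{1..2 * l}"
  have v: "v \<in> vertices (2 * l)" and I: "I \<subseteq> ?D" "card I = l"
    using assms by (auto simp: c cells_def)
  have fin: "finite I" using I finite_subset by blast
  define base where "base k = unshift v {j \<in> ?D - I. k < j}" for k
  have cup1_at: "cup1 l (indicator_cochain c) (indicator_cochain t) (u, ?D) =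
    (\<Sum>k\<in>I. of_bool (t = cup1_succ l c k \<and> u = base k))" for u
  proof -
    let ?S = "\<lambda>k. {(I, J). I \<union> J = ?D - {k} \<and> I \<inter> J = {} \<and> card I = l - 1}"
    let ?h = "\<lambda>k (I', J). indicator_cochain c (shift u {j \<in> J. k < j}, insert k I') *
      indicator_cochain t (shift u {i \<in> I'. i < k}, insert k J)"
    have inside: "sum (?h k) (?S k) = of_bool (t = cup1_succ l c k \<and> u = base k)" if "k \<in> I" for k
    proof -
      have vanish: "?h k p = 0" if p: "p \<in> ?S k" "p \<noteq> (I - {k}, ?D - I)" for p
      proof -
        obtain I' J where p_eq: "p = (I', J)" by (cases p)
        have "I \<noteq> insert k I'" using p I(1) \<open>k \<in> I\<close> unfolding p_eq by blast
        thus ?thesis by (simp add: p_eq c indicator_cochain_def)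
      qed
      have "(I - {k}, ?D - I) \<in> ?S k" using I that by auto
      hence "sum (?h k) (?S k) = sum (?h k) {(I - {k}, ?D - I)}"
        using vanish by (intro sum.mono_neutral_right finite_splittings) blast+
      moreover have "{i \<in> I - {k}. i < k} = {i \<in> I. i < k}" by auto
      ultimately show ?thesis using that
        by (auto simp: c indicator_cochain_def cup1_succ_def base_def shift_eq_iff insert_absorb)
    qed
    have outside: "sum (?h k) (?S k) = 0" if "k \<notin> I" for k
      using that by (intro sum.neutral) (auto simp: c indicator_cochain_def)
    have "(\<Sum>k\<in>?D. sum (?h k) (?S k)) = (\<Sum>k\<in>I. of_bool (t = cup1_succ l c k \<and> u = base k))"
      using I outside inside by (intro sum.mono_neutral_cong_right) auto
    thus ?thesis by (simp add: cup1_def)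
  qed
  show ?thesis
  proof (cases "t \<in> cup1_succ l c ` snd c")
    case True
    then obtain k where k: "k \<in> I" "t = cup1_succ l c k" by (auto simp: c)
    have "integral (2 * l) (cup1 l (indicator_cochain c) (indicator_cochain t)) = of_bool True"
    proof (rule integral_eq_of_bool)
      show "base k \<in> vertices (2 * l)"
        unfolding base_def by (intro unshift_in_vertices v) auto
      fix u
      show "cup1 l (indicator_cochain c) (indicator_cochain t) (u, ?D) =
        of_bool (u = base k \<and> True)"
        unfolding cup1_at using k cup1_succ_inj[of _ c k l]
        by (subst sum_of_bool_unique[OF fin, of _ k]) (auto simp: c)
    qed
    thus ?thesis using True by (simp add: int_cup1_cell_left_def)
  next
    case False
    have "integral (2 * l) (cup1 l (indicator_cochain c) (indicator_cochain t)) = of_bool False"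
      using False
      by (intro integral_eq_of_bool[OF v], unfold cup1_at) (auto simp: c intro!: sum.neutral)
    thus ?thesis using False by (simp add: int_cup1_cell_left_def)
  qed
qed

section \<open>The Leibniz rule for the cup-1 product\<close>

text \<open>
  These are \<open>\<integral> \<delta>x \<union>\<^sub>1 a\<close> and \<open>\<integral> a \<union>\<^sub>1 \<delta>x\<close> in explicit form.
\<close>

definition cup1_d_left :: "nat \<Rightarrow> cell \<Rightarrow> cell \<Rightarrow> bit" where
  "cup1_d_left l x a = (\<Sum>k\<in>snd a. incidence x (cup1_pred l a k))"

definition cup1_d_right :: "nat \<Rightarrow> cell \<Rightarrow> cell \<Rightarrow> bit" where
  "cup1_d_right l a x = (\<Sum>k\<in>snd a. incidence x (cup1_succ l a k))"

lemma telescoping_bit: "(\<Sum>k=1..n. G k + G (Suc k)) = G 1 + (G (Suc n) :: bit)"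
  by (induction n) (simp_all add: add.assoc)

lemma sum_sum_single:
  assumes "finite S" "\<And>k. k \<in> S \<Longrightarrow> finite (T k)" "x \<in> S" "y \<in> T x"
    and h: "\<And>k i. k \<in> S \<Longrightarrow> i \<in> T k \<Longrightarrow> \<not> (k = x \<and> i = y) \<Longrightarrow> h k i = 0"
  shows "(\<Sum>k\<in>S. \<Sum>i\<in>T k. h k i) = h x y"
proof -
  have "(\<Sum>k\<in>S. \<Sum>i\<in>T k. h k i) = (\<Sum>i\<in>T x. h x i) + (\<Sum>k\<in>S - {x}. \<Sum>i\<in>T k. h k i)"
    using assms by (intro sum.remove) auto
  also have "(\<Sum>k\<in>S - {x}. \<Sum>i\<in>T k. h k i) = 0"
    using h by (intro sum.neutral ballI) auto
  also have "(\<Sum>i\<in>T x. h x i) = h x y + (\<Sum>i\<in>T x - {y}. h x i)"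
    using assms by (intro sum.remove) auto
  also have "(\<Sum>i\<in>T x - {y}. h x i) = 0"
    using h assms(3) by (intro sum.neutral ballI) auto
  finally show ?thesis by simp
qed

text \<open>
  The integrated Leibniz rule \<open>\<integral> c \<union> c' + c' \<union> c = \<integral> \<delta>c \<union>\<^sub>1 c' + c \<union>\<^sub>1 \<delta>c'\<close>. If the directions of the
  two cells are complementary, the terms on the right, ordered by the shared direction \<open>k\<close>, telescope along a
  lattice path from the vertex offset \<open>e\<^sub>J\<close> to \<open>- e\<^sub>I\<close>, and these two ends are the two cup products. Otherwise
  the cup products vanish, and the right-hand side vanishes too unless the cells share exactly one direction \<open>x\<close>
  and both miss exactly one direction \<open>y\<close>; then each of the two sums has two terms, and they cancel in pairs.
\<close>

lemma cup1_identity: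
  assumes "c \<in> cells (2 * l) l" "c' \<in> cells (2 * l) l"
  shows "of_bool (c' = cup_succ l c) + of_bool (c = cup_succ l c') =
    cup1_d_left l c c' + cup1_d_right l c c'"
proof -
  obtain v I where c: "c = (v, I)" by (cases c)
  obtain w J where c': "c' = (w, J)" by (cases c')
  let ?D = "{1..2 * l}"
  have I: "I \<subseteq> ?D" and J: "J \<subseteq> ?D"
    using assms by (auto simp: c c' cells_def)
  have fin: "finite I" "finite J" using I J finite_subset by blast+
  define a where "a k = shift (unshift w {i \<in> ?D - J. i < k}) {j \<in> J. k < j}" for k
  define b where "b k = shift (unshift v {j \<in> ?D - I. k < j}) {i \<in> I. i < k}" for k
  let ?L = "\<lambda>k i. of_bool (I = insert k (?D - J) - {i} \<and> v = a k) +
      of_bool (I = insert k (?D - J) - {i} \<and> v = shift (a k) {i}) :: bit"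
  let ?R = "\<lambda>k j. of_bool (J = insert k (?D - I) - {j} \<and> w = b k) +
      of_bool (J = insert k (?D - I) - {j} \<and> w = shift (b k) {j}) :: bit"
  have L: "cup1_d_left l c c' = (\<Sum>k\<in>J. \<Sum>i\<in>insert k (?D - J). ?L k i)"
    unfolding cup1_d_left_def c c' cup1_pred_def a_def prod.case snd_conv incidence_eq
    by (simp only: prod.inject conj_commute)
  have R: "cup1_d_right l c c' = (\<Sum>k\<in>I. \<Sum>j\<in>insert k (?D - I). ?R k j)"
    unfolding cup1_d_right_def c c' cup1_succ_def b_def prod.case snd_conv incidence_eq
    by (simp only: prod.inject conj_commute)
  show ?thesis
  proof (cases "J = ?D - I")
    case True
    hence I': "I = ?D - J" using I by auto
    \<comment> \<open>\<open>G k\<close> tests whether \<open>v - w\<close> is the \<open>k\<close>-th point of the lattice path; the term at \<open>k\<close> contributes \<open>G k + G (k + 1)\<close>.\<close>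
    define G where "G k = (of_bool (v = shift (unshift w {i \<in> I. i < k}) {j \<in> J. k \<le> j}) :: bit)"
      for k
    have "(\<Sum>i\<in>insert k (?D - J). ?L k i) = G k + G (Suc k)" if "k \<in> J" for k
    proof -
      have "k \<notin> I" using that I' by auto
      have "(\<Sum>i\<in>insert k (?D - J). ?L k i) = (\<Sum>i\<in>{k}. ?L k i)"
        using \<open>k \<notin> I\<close> by (intro sum.mono_neutral_right) (auto simp: I'[symmetric])
      also have "\<dots> = of_bool (v = a k) + of_bool (v = shift (a k) {k})"
        unfolding I'[symmetric] using \<open>k \<notin> I\<close> by simp
      finally have single_term:
        "(\<Sum>i\<in>insert k (?D - J). ?L k i) = of_bool (v = a k) + of_bool (v = shift (a k) {k})" .
      have 1: "(v = a k) = (v = shift (unshift w {i \<in> I. i < Suc k}) {j \<in> J. Suc k \<le> j})"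
        unfolding a_def I'[symmetric] fun_eq_iff shift_def unshift_def
        using \<open>k \<notin> I\<close> by (intro iff_allI) (auto simp: less_Suc_eq Suc_le_eq)
      have 2: "(v = shift (a k) {k}) = (v = shift (unshift w {i \<in> I. i < k}) {j \<in> J. k \<le> j})"
        unfolding a_def I'[symmetric] fun_eq_iff shift_def unshift_def
        using that by (intro iff_allI) (auto simp: le_less)
      show ?thesis unfolding single_term unfolding 1 2 G_def by (rule add.commute)
    qed
    hence "cup1_d_left l c c' = (\<Sum>k\<in>J. G k + G (Suc k))" unfolding L by (intro sum.cong) auto
    moreover have "(\<Sum>j\<in>insert k (?D - I). ?R k j) = G k + G (Suc k)" if "k \<in> I" for k
    proof -
      have "k \<notin> J" using that True by auto
      have "(\<Sum>j\<in>insert k (?D - I). ?R k j) = (\<Sum>j\<in>{k}. ?R k j)"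
        using \<open>k \<notin> J\<close> by (intro sum.mono_neutral_right) (auto simp: True[symmetric])
      also have "\<dots> = of_bool (w = b k) + of_bool (w = shift (b k) {k})"
        unfolding True[symmetric] using \<open>k \<notin> J\<close> by simp
      finally have single_term:
        "(\<Sum>j\<in>insert k (?D - I). ?R k j) = of_bool (w = b k) + of_bool (w = shift (b k) {k})" .
      have 1: "(w = b k) = (v = shift (unshift w {i \<in> I. i < k}) {j \<in> J. k \<le> j})"
        unfolding b_def True[symmetric] fun_eq_iff shift_def unshift_def
        using \<open>k \<notin> J\<close> by (intro iff_allI) (auto simp: le_less)
      have 2: "(w = shift (b k) {k}) =
        (v = shift (unshift w {i \<in> I. i < Suc k}) {j \<in> J. Suc k \<le> j})"
        unfolding b_def True[symmetric] fun_eq_iff shift_def unshift_def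
        using that by (intro iff_allI) (auto simp: less_Suc_eq Suc_le_eq)
      show ?thesis unfolding single_term unfolding 1 2 G_def ..
    qed
    hence "cup1_d_right l c c' = (\<Sum>k\<in>I. G k + G (Suc k))" unfolding R by (intro sum.cong) auto
    moreover have "(\<Sum>k\<in>J. G k + G (Suc k)) + (\<Sum>k\<in>I. G k + G (Suc k)) =
      (\<Sum>k\<in>?D. G k + G (Suc k))"
      using I fin by (subst sum.union_disjoint[symmetric]) (auto simp: True intro!: sum.cong)
    moreover have "G 1 = of_bool (c = cup_succ l c')"
    proof -
      have 1: "{i \<in> I. i < 1} = {}" "{j \<in> J. 1 \<le> j} = J" using I J by auto
      have 2: "unshift w {} = w" by (simp add: unshift_def)
      show ?thesis unfolding G_def 1 2 c c' cup_succ_def prod.case I'[symmetric] by simp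
    qed
    moreover have "G (Suc (2 * l)) = of_bool (c' = cup_succ l c)"
    proof -
      have 1: "{i \<in> I. i < Suc (2 * l)} = I" "{j \<in> J. Suc (2 * l) \<le> j} = {}"
        using I J by auto
      have 2: "shift u {} = u" for u by (simp add: shift_def)
      have "v = unshift w I \<longleftrightarrow> w = shift v I" using shift_eq_iff[of v I w] by metis
      thus ?thesis unfolding G_def 1 2 c c' cup_succ_def prod.case True[symmetric] by simp
    qed
    ultimately show ?thesis by (simp only: telescoping_bit add.commute)
  next
    case False
    hence "I \<noteq> ?D - J" using J by auto
    have cup0: "c' \<noteq> cup_succ l c" "c \<noteq> cup_succ l c'"
      using False \<open>I \<noteq> ?D - J\<close> by (auto simp: c c' cup_succ_def)
    \<comment> \<open>\<open>k\<close> is the shared and \<open>i\<close> the missing direction; the condition is symmetric in the two cells.\<close>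
    define pivot where "pivot k i \<longleftrightarrow> k \<in> J \<and> i \<in> ?D - J \<and> I = insert k (?D - J) - {i}" for k i
    have pivot_L: "pivot k i" if "k \<in> J" "i \<in> insert k (?D - J)" "I = insert k (?D - J) - {i}" for k i
      using that \<open>I \<noteq> ?D - J\<close> by (auto simp: pivot_def)
    have L_zero: "?L k i = 0" if "k \<in> J" "i \<in> insert k (?D - J)" "\<not> pivot k i" for k i
    proof -
      have "I \<noteq> insert k (?D - J) - {i}" using pivot_L that by blast
      thus ?thesis by simp
    qed
    have pivot_R: "pivot k j" if "k \<in> I" "j \<in> insert k (?D - I)" "J = insert k (?D - I) - {j}" for k j
    proof -
      have "j \<noteq> k" using that False by auto
      thus ?thesis using that I by (auto simp: pivot_def)
    qed
    have R_zero: "?R k j = 0" if "k \<in> I" "j \<in> insert k (?D - I)" "\<not> pivot k j" for k j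
    proof -
      have "J \<noteq> insert k (?D - I) - {j}" using pivot_R that by blast
      thus ?thesis by simp
    qed
    show ?thesis
    proof (cases "\<exists>x y. pivot x y")
      case False
      have "cup1_d_left l c c' = 0" unfolding L
        using False L_zero by (intro sum.neutral ballI) blast
      moreover have "cup1_d_right l c c' = 0" unfolding R
        using False R_zero by (intro sum.neutral ballI) blast
      ultimately show ?thesis using cup0 by simp
    next
      case True
      then obtain x y where xy: "pivot x y" by blast
      have unique: "k = x \<and> i = y" if "pivot k i" for k i
        using that xy unfolding pivot_def by blast
      have x: "x \<in> J" "x \<in> I" and y: "y \<in> ?D - J" "y \<in> ?D - I" and "x \<noteq> y"
        and IJ: "I = insert x (?D - J) - {y}"
        using xy I J by (auto simp: pivot_def)
      have JI: "J = insert x (?D - I) - {y}" using IJ x y J by auto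
      have "cup1_d_left l c c' = ?L x y" unfolding L
        using x y fin unique L_zero by (intro sum_sum_single) blast+
      also have "\<dots> = of_bool (v = a x) + of_bool (v = shift (a x) {y})"
        unfolding IJ[symmetric] by simp
      finally have L': "cup1_d_left l c c' = of_bool (v = a x) + of_bool (v = shift (a x) {y})" .
      have "cup1_d_right l c c' = ?R x y" unfolding R
        using x y fin unique R_zero by (intro sum_sum_single) blast+
      also have "\<dots> = of_bool (w = b x) + of_bool (w = shift (b x) {y})"
        unfolding JI[symmetric] by simp
      finally have R': "cup1_d_right l c c' = of_bool (w = b x) + of_bool (w = shift (b x) {y})" .
      have mem: "i \<in> ?D - J \<longleftrightarrow> i = y \<or> i \<in> I \<and> i \<noteq> x" "i \<in> ?D - I \<longleftrightarrow> i = y \<or> i \<in> J \<and> i \<noteq> x" for i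
        using IJ JI x y I J by blast+
      have y': "y \<notin> I" "y \<notin> J" using y by auto
      have 1: "v = a x \<longleftrightarrow> w = shift (b x) {y}"
        unfolding a_def b_def fun_eq_iff shift_def unshift_def mem_Collect_eq mem
        using x y' \<open>x \<noteq> y\<close> by (intro iff_allI) auto
      have 2: "v = shift (a x) {y} \<longleftrightarrow> w = b x"
        unfolding a_def b_def fun_eq_iff shift_def unshift_def mem_Collect_eq mem
        using x y' \<open>x \<noteq> y\<close> by (intro iff_allI) auto
      show ?thesis unfolding L' R' 1 2 using cup0 by (simp add: add.commute)
    qed
  qed
qed

text \<open>
  The cells in the first sum are those in the coboundary of \<open>(w, K)\<close>. A cell \<open>(u, T)\<close>
  contributes only if \<open>T = K \<union> {p, q}\<close>; the directions \<open>p\<close> and \<open>q\<close> can then be removed in either order, and the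
  two orders cancel.
\<close>

lemma coboundary_coboundary:
  assumes "K \<subseteq> {1..d}" "T \<subseteq> {1..d}"
  shows "(\<Sum>i\<in>{1..d} - K. incidence (w, insert i K) (u, T) + incidence (unshift w {i}, insert i K) (u, T)) = 0"
proof -
  let ?D = "{1..d}"
  let ?h = "\<lambda>i j. of_bool (w = u) + of_bool (w = shift u {j}) + of_bool (w = shift u {i}) +
    of_bool (w = shift (shift u {j}) {i}) :: bit"
  have eq: "unshift w {i} = z \<longleftrightarrow> w = shift z {i}" for i z
    using shift_unshift by metis
  have expand: "incidence (w, insert i K) (u, T) + incidence (unshift w {i}, insert i K) (u, T) =
    (\<Sum>j\<in>T. of_bool (insert i K = T - {j}) * ?h i j)" for i
    unfolding incidence_eq sum.distrib[symmetric]
    by (intro sum.cong refl) (simp add: eq add.assoc add.left_commute)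
  have fin: "finite T" using assms finite_subset by blast
  show ?thesis
  proof (cases "\<exists>p q. p \<in> ?D - K \<and> q \<in> T \<and> insert p K = T - {q}")
    case False
    thus ?thesis unfolding expand by (intro sum.neutral ballI) auto
  next
    case True
    then obtain p q where pq: "p \<in> ?D - K" "q \<in> T" "insert p K = T - {q}" by blast
    have "p \<noteq> q" "p \<in> T" "q \<in> ?D - K" using pq assms by auto
    have cond: "insert i K = T - {j} \<longleftrightarrow> i = p \<and> j = q \<or> i = q \<and> j = p"
      if "i \<in> ?D - K" "j \<in> T" for i j
    proof -
      have T: "T = insert p (insert q K)" using pq by auto
      show ?thesis using that pq(1) \<open>q \<in> ?D - K\<close> \<open>p \<noteq> q\<close> unfolding T by auto
    qed
    have "(\<Sum>i\<in>?D - K. \<Sum>j\<in>T. of_bool (insert i K = T - {j}) * ?h i j) =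
      (\<Sum>i\<in>?D - K. \<Sum>j\<in>T. (if i = p then if j = q then ?h p q else 0 else 0) +
        (if i = q then if j = p then ?h q p else 0 else 0))"
      using \<open>p \<noteq> q\<close> by (intro sum.cong refl) (simp only: cond, auto)
    also have "\<dots> = (\<Sum>i\<in>?D - K. (if i = p then ?h p q else 0) + (if i = q then ?h q p else 0))"
      using fin pq \<open>p \<in> T\<close> by (intro sum.cong refl) (simp add: sum.distrib)
    also have "\<dots> = ?h p q + ?h q p"
      using pq(1) \<open>q \<in> ?D - K\<close> by (simp add: sum.distrib)
    also have "\<dots> = 0"
    proof -
      have "shift (shift u {q}) {p} = shift (shift u {p}) {q}" by (simp add: shift_def fun_eq_iff)
      thus ?thesis by (simp add: ac_simps)
    qed
    finally show ?thesis unfolding expand .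
  qed
qed

section \<open>Neighbouring cells and distances\<close>

lemma cell_finite: "c \<in> cells d n \<Longrightarrow> finite (snd c)"
  by (auto simp: cells_def dest: finite_subset[OF _ finite_atLeastAtMost])

lemma card_complement:
  assumes "J \<subseteq> {1..2 * l}" "card J = l"
  shows "card ({1..2 * l} - J) = l"
  using assms finite_subset[OF assms(1)] by (simp add: card_Diff_subset)

lemma cup_succ_in_cells: "c \<in> cells (2 * l) l \<Longrightarrow> cup_succ l c \<in> cells (2 * l) l"
  using shift_in_vertices[of "fst c" "2 * l" "snd c"] card_complement[of "snd c" l]
  by (cases c) (simp add: cells_def cup_succ_def)

lemma cup_pred_in_cells: "c \<in> cells (2 * l) l \<Longrightarrow> cup_pred l c \<in> cells (2 * l) l"
  using unshift_in_vertices[of "fst c" "2 * l" "{1..2 * l} - snd c"] card_complement[of "snd c" l]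
  by (cases c) (simp add: cells_def cup_pred_def)

lemma cup_succ_eq_iff:
  assumes "c \<in> cells (2 * l) l" "c' \<in> cells (2 * l) l"
  shows "c' = cup_succ l c \<longleftrightarrow> c = cup_pred l c'"
proof -
  obtain v I w J where c: "c = (v, I)" "c' = (w, J)" by (cases c, cases c')
  have "I \<subseteq> {1..2 * l}" "J \<subseteq> {1..2 * l}" using assms by (auto simp: c cells_def)
  hence "J = {1..2 * l} - I \<longleftrightarrow> I = {1..2 * l} - J" and "J = {1..2 * l} - I \<Longrightarrow> {1..2 * l} - J = I"
    by blast+
  moreover have "w = shift v I \<longleftrightarrow> v = unshift w I" using shift_unshift by metis
  ultimately show ?thesis unfolding c cup_succ_def cup_pred_def prod.case prod.inject by metis
qed

lemma cup1_in_cells: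
  assumes "c \<in> cells (2 * l) l" "k \<in> snd c"
  shows "cup1_pred l c k \<in> cells (2 * l) (l + 1)" "cup1_succ l c k \<in> cells (2 * l) (l + 1)"
proof -
  obtain w J where c: "c = (w, J)" by (cases c)
  have w: "w \<in> vertices (2 * l)" "J \<subseteq> {1..2 * l}" "card J = l" "k \<in> J"
    using assms by (auto simp: c cells_def)
  hence "card (insert k ({1..2 * l} - J)) = l + 1"
    using card_complement by (simp add: card_insert_disjoint)
  moreover have "insert k ({1..2 * l} - J) \<subseteq> {1..2 * l}" using w by auto
  moreover have "shift (unshift w {i \<in> {1..2 * l} - J. i < k}) {j \<in> J. k < j} \<in> vertices (2 * l)"
    using w by (intro shift_in_vertices unshift_in_vertices) auto
  moreover have "shift (unshift w {j \<in> {1..2 * l} - J. k < j}) {i \<in> J. i < k} \<in> vertices (2 * l)"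
    using w by (intro shift_in_vertices unshift_in_vertices) auto
  ultimately show "cup1_pred l c k \<in> cells (2 * l) (l + 1)" "cup1_succ l c k \<in> cells (2 * l) (l + 1)"
    unfolding c cup1_pred_def cup1_succ_def cells_def case_prod_conv mem_Collect_eq by blast+
qed

definition faces :: "cell \<Rightarrow> cell set" where
  "faces t = (\<lambda>i. (fst t, snd t - {i})) ` snd t \<union> (\<lambda>i. (shift (fst t) {i}, snd t - {i})) ` snd t"

lemma incidence_nonzero: "incidence x t \<noteq> 0 \<Longrightarrow> x \<in> faces t"
proof (rule ccontr)
  obtain u T where t: "t = (u, T)" by (cases t)
  assume "x \<notin> faces t" "incidence x t \<noteq> 0"
  moreover from this have "incidence x t = 0" unfolding t incidence_eq
    by (intro sum.neutral) (auto simp: faces_def t)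
  ultimately show False by simp
qed

lemma faces_subset_cells: "t \<in> cells d (n + 1) \<Longrightarrow> faces t \<subseteq> cells d n"
  by (auto simp: cells_def faces_def shift_in_vertices finite_subset)

lemma finite_faces: "finite (snd t) \<Longrightarrow> finite (faces t)"
  by (simp add: faces_def)

definition near :: "int \<Rightarrow> cell \<Rightarrow> cell \<Rightarrow> bool" where
  "near r c c' \<longleftrightarrow> (\<forall>i. \<bar>fst c i - fst c' i\<bar> \<le> r)"

lemma near_trans: "near r a b \<Longrightarrow> near s b c \<Longrightarrow> near (r + s) a c"
proof -
  assume ab: "near r a b" and bc: "near s b c"
  have "\<bar>fst a i - fst c i\<bar> \<le> r + s" for i
    using ab[unfolded near_def, rule_format, of i] bc[unfolded near_def, rule_format, of i]
    by linarith
  thus ?thesis by (simp add: near_def)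
qed

lemma near_mono: "near r a b \<Longrightarrow> r \<le> s \<Longrightarrow> near s a b"
  unfolding near_def by (meson order_trans)

lemma near_refl: "near 0 a a"
  by (simp add: near_def)

lemma near_partners:
  "near 1 c (cup_succ l c)" "near 1 c (cup_pred l c)"
  "near 1 c (cup1_pred l c k)" "near 1 c (cup1_succ l c k)"
  by (auto simp: near_def cup_succ_def cup_pred_def cup1_pred_def cup1_succ_def shift_def
      unshift_def split: prod.splits)

lemma near_faces: "x \<in> faces t \<Longrightarrow> near 1 t x"
  by (auto simp: near_def faces_def shift_def)

lemma qubit_dist_near:
  assumes "near r c c'"
  shows "qubit_dist l (\<alpha>, c) (\<beta>, c') \<le> 2 * int l * r"
proof -
  obtain v I w J where c: "c = (v, I)" "c' = (w, J)" by (cases c, cases c')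
  have "(\<Sum>i\<in>{1..2 * l}. \<bar>v i - w i\<bar>) \<le> of_nat (card {1..2 * l}) * r"
    using assms by (intro sum_bounded_above) (simp add: near_def c)
  thus ?thesis by (simp add: qubit_dist_def c)
qed

text \<open>
  The cells on which the \<open>Z\<close>-parts of the four operators at \<open>c\<close> may be nonzero.
\<close>

definition nbrs :: "nat \<Rightarrow> cell \<Rightarrow> cell set" where
  "nbrs l c = {cup_succ l c, cup_pred l c} \<union>
     (\<Union>k\<in>snd c. faces (cup1_pred l c k) \<union> faces (cup1_succ l c k))"

lemma nbrs_in_cells: "c \<in> cells (2 * l) l \<Longrightarrow> nbrs l c \<subseteq> cells (2 * l) l"
  using faces_subset_cells cup1_in_cells cup_succ_in_cells cup_pred_in_cells
  unfolding nbrs_def by blast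

lemma finite_nbrs: "c \<in> cells (2 * l) l \<Longrightarrow> finite (nbrs l c)"
  unfolding nbrs_def
  by (auto intro!: finite_faces dest: cup1_in_cells cell_finite intro: cell_finite)

lemma near_nbrs: "x \<in> nbrs l c \<Longrightarrow> near 2 c x"
proof -
  assume "x \<in> nbrs l c"
  then consider "near 1 c x" | k where "x \<in> faces (cup1_pred l c k)"
    | k where "x \<in> faces (cup1_succ l c k)"
    unfolding nbrs_def using near_partners by blast
  thus ?thesis
    using near_trans[OF near_partners(3) near_faces] near_trans[OF near_partners(4) near_faces]
    by cases (auto intro: near_mono)
qed

section \<open>The generators as Pauli operators\<close>

definition on_species :: "species \<Rightarrow> cochain \<Rightarrow> qubit \<Rightarrow> bit" where
  "on_species \<alpha> h = (\<lambda>(\<beta>, x). of_bool (\<beta> = \<alpha>) * h x)"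

lemma on_species_apply [simp]: "on_species \<alpha> h (\<beta>, x) = of_bool (\<beta> = \<alpha>) * h x"
  by (simp add: on_species_def)

lemma on_species_indicator: "on_species \<alpha> (\<lambda>x. of_bool (x = y)) = single (\<alpha>, y)"
  by (auto simp: single_def fun_eq_iff)

lemma on_species_add: "on_species \<alpha> (\<lambda>x. h x + h' x) = (\<lambda>q. on_species \<alpha> h q + on_species \<alpha> h' q)"
  by (simp add: on_species_def fun_eq_iff distrib_left)

lemma supp_subset_UNIV_times:
  assumes "\<And>\<alpha> x. x \<notin> K \<Longrightarrow> g (\<alpha>, x) = 0"
  shows "supp g \<subseteq> UNIV \<times> K"
proof
  fix q assume "q \<in> supp g"
  moreover obtain \<alpha> x where "q = (\<alpha>, x)" by (cases q)
  ultimately show "q \<in> UNIV \<times> K" using assms[of x \<alpha>] by (auto simp: supp_def)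
qed

lemma finite_species: "finite (UNIV :: species set)"
proof -
  have "UNIV = {Type_A, Type_B}" using species.exhaust by blast
  thus ?thesis by (metis finite.emptyI finite.insertI)
qed

lemma finite_supp_on_species:
  assumes "finite K" "\<And>x. h x \<noteq> 0 \<Longrightarrow> x \<in> K"
  shows "finite (supp (on_species \<alpha> h))"
proof (rule finite_subset)
  have "h x = 0" if "x \<notin> K" for x using that assms(2) by blast
  thus "supp (on_species \<alpha> h) \<subseteq> UNIV \<times> K" by (intro supp_subset_UNIV_times) simp
  show "finite ((UNIV :: species set) \<times> K)" using finite_species assms(1) by simp
qed

lemma op_prod_pauli_Z:
  assumes "finite K" "K \<subseteq> S" "\<And>x. h x \<noteq> 0 \<Longrightarrow> x \<in> K" and k: "\<And>x. x \<in> S \<Longrightarrow> k x = h x"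
  shows "op_prod (\<lambda>x. op_pow (pauli_Z (\<alpha>, x)) (k x)) S = pauli no_qubit (on_species \<alpha> h)"
proof -
  let ?g = "\<lambda>x q. h x * single (\<alpha>, x) q"
  have "op_prod (\<lambda>x. op_pow (pauli_Z (\<alpha>, x)) (k x)) S = pauli no_qubit (\<lambda>q. \<Sum>x\<in>K. ?g x q)"
  proof (rule op_prod_Z[OF _ _ assms(1,2)])
    fix x assume "x \<in> S"
    show "op_pow (pauli_Z (\<alpha>, x)) (k x) = pauli no_qubit (?g x)"
      by (simp add: k \<open>x \<in> S\<close> pauli_Z_eq op_pow_Z)
    have "supp (?g x) \<subseteq> {(\<alpha>, x)}" by (auto simp: supp_def single_def)
    thus "finite (supp (?g x))" using finite_subset by blast
  next
    fix x q assume "x \<in> S - K"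
    hence "h x = 0" using assms(3) by blast
    thus "?g x q = 0" by simp
  qed
  moreover have "(\<Sum>x\<in>K. ?g x q) = on_species \<alpha> h q" for q
  proof -
    obtain \<beta> y where q: "q = (\<beta>, y)" by (cases q)
    have "(\<Sum>x\<in>K. ?g x q) = (\<Sum>x\<in>K. if y = x then of_bool (\<beta> = \<alpha>) * h y else 0)"
      by (intro sum.cong) (auto simp: q single_def)
    also have "\<dots> = on_species \<alpha> h q"
      using assms(1) assms(3)[of y] by (cases "h y") (auto simp: q)
    finally show ?thesis .
  qed
  ultimately show ?thesis by (simp only:)
qed

lemma W_op_eq:
  assumes "t \<in> cells (2 * l) (l + 1)"
  shows "W_op l \<alpha> t = pauli no_qubit (on_species \<alpha> (\<lambda>x. incidence x t))"
  unfolding W_op_def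
proof (rule op_prod_pauli_Z)
  show "finite (faces t)" using assms by (intro finite_faces cell_finite)
  show "faces t \<subseteq> cells (2 * l) l" using assms by (rule faces_subset_cells)
qed (use incidence_nonzero in auto)

lemma finite_supp_incidence:
  "t \<in> cells d n \<Longrightarrow> finite (supp (on_species \<alpha> (\<lambda>x. incidence x t)))"
  by (rule finite_supp_on_species[OF finite_faces[OF cell_finite] incidence_nonzero])

lemma op_prod_W:
  assumes "finite M" "M \<subseteq> cells (2 * l) (l + 1)"
  shows "op_prod (\<lambda>t. op_pow (W_op l \<alpha> t) (of_bool (t \<in> M))) (cells (2 * l) (l + 1)) =
    pauli no_qubit (on_species \<alpha> (\<lambda>x. \<Sum>t\<in>M. incidence x t))"
proof -
  let ?g = "\<lambda>t q. of_bool (t \<in> M) * on_species \<alpha> (\<lambda>x. incidence x t) q"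
  have "op_prod (\<lambda>t. op_pow (W_op l \<alpha> t) (of_bool (t \<in> M))) (cells (2 * l) (l + 1)) =
    pauli no_qubit (\<lambda>q. \<Sum>t\<in>M. ?g t q)"
  proof (rule op_prod_Z[OF _ _ assms])
    fix t assume t: "t \<in> cells (2 * l) (l + 1)"
    show "op_pow (W_op l \<alpha> t) (of_bool (t \<in> M)) = pauli no_qubit (?g t)"
      by (simp only: W_op_eq[OF t] op_pow_Z)
    show "finite (supp (?g t))"
      using finite_supp_incidence[OF t] by (cases "t \<in> M") simp_all
  qed simp
  moreover have "(\<Sum>t\<in>M. ?g t q) = on_species \<alpha> (\<lambda>x. \<Sum>t\<in>M. incidence x t) q" for q
    by (cases q) (simp add: sum_distrib_left)
  ultimately show ?thesis by (simp only:)
qed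

lemma op_prod_cup1_right:
  assumes c: "c \<in> cells (2 * l) l"
  shows "op_prod (\<lambda>t. op_pow (W_op l \<alpha> t) (int_cup1_cell_right l t c)) (cells (2 * l) (l + 1)) =
    pauli no_qubit (on_species \<alpha> (\<lambda>x. cup1_d_left l x c))"
proof -
  have "inj_on (cup1_pred l c) (snd c)" using cup1_pred_inj by (auto simp: inj_on_def)
  hence "(\<Sum>t\<in>cup1_pred l c ` snd c. incidence x t) = cup1_d_left l x c" for x
    by (simp add: sum.reindex cup1_d_left_def)
  moreover have "finite (cup1_pred l c ` snd c)" using cell_finite[OF c] by simp
  moreover have "cup1_pred l c ` snd c \<subseteq> cells (2 * l) (l + 1)" using cup1_in_cells c by blast
  ultimately show ?thesis
    unfolding int_cup1_cell_right_eq[OF c] by (simp only: op_prod_W)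
qed

lemma op_prod_cup1_left:
  assumes c: "c \<in> cells (2 * l) l"
  shows "op_prod (\<lambda>t. op_pow (W_op l \<alpha> t) (int_cup1_cell_left l c t)) (cells (2 * l) (l + 1)) =
    pauli no_qubit (on_species \<alpha> (\<lambda>x. cup1_d_right l c x))"
proof -
  have "inj_on (cup1_succ l c) (snd c)" using cup1_succ_inj by (auto simp: inj_on_def)
  hence "(\<Sum>t\<in>cup1_succ l c ` snd c. incidence x t) = cup1_d_right l c x" for x
    by (simp add: sum.reindex cup1_d_right_def)
  moreover have "finite (cup1_succ l c ` snd c)" using cell_finite[OF c] by simp
  moreover have "cup1_succ l c ` snd c \<subseteq> cells (2 * l) (l + 1)" using cup1_in_cells c by blast
  ultimately show ?thesis
    unfolding int_cup1_cell_left_eq[OF c] by (simp only: op_prod_W)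
qed

lemma op_prod_cup_right:
  assumes "c \<in> cells (2 * l) l"
  shows "op_prod (\<lambda>c'. op_pow (pauli_Z (\<alpha> :: species, c')) (int_cup l c c')) (cells (2 * l) l) =
    pauli no_qubit (single (\<alpha>, cup_succ l c))"
  by (subst op_prod_pauli_Z[where K = "{cup_succ l c}" and h = "\<lambda>x. of_bool (x = cup_succ l c)"])
    (use assms in \<open>auto simp: int_cup_eq cup_succ_in_cells on_species_indicator\<close>)

lemma op_prod_cup_left:
  assumes "c \<in> cells (2 * l) l"
  shows "op_prod (\<lambda>c'. op_pow (pauli_Z (\<alpha> :: species, c')) (int_cup l c' c)) (cells (2 * l) l) =
    pauli no_qubit (single (\<alpha>, cup_pred l c))"
  by (subst op_prod_pauli_Z[where K = "{cup_pred l c}" and h = "\<lambda>x. of_bool (x = cup_pred l c)"])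
    (use assms in \<open>auto simp: int_cup_eq cup_pred_in_cells on_species_indicator cup_succ_eq_iff\<close>)

text \<open>
  The \<open>Z\<close>-parts of the generators: cup products appear as single qubits, and the products of \<open>W\<close> operators
  as integrals of \<open>\<union>\<^sub>1\<close> products, by linearity in the \<open>(l + 1)\<close>-cells.
\<close>

fun A_Z :: "nat \<Rightarrow> species \<Rightarrow> cell \<Rightarrow> qubit \<Rightarrow> bit" where
  "A_Z l Type_A c = (\<lambda>q. single (Type_A, cup_succ l c) q +
     on_species Type_A (\<lambda>x. cup1_d_left l x c) q)"
| "A_Z l Type_B c = (\<lambda>q. single (Type_B, cup_succ l c) q +
     on_species Type_B (\<lambda>x. cup1_d_right l c x) q + single (Type_A, cup_succ l c) q)"

fun A_bar_Z :: "nat \<Rightarrow> species \<Rightarrow> cell \<Rightarrow> qubit \<Rightarrow> bit" where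
  "A_bar_Z l Type_A c = (\<lambda>q. single (Type_A, cup_succ l c) q +
     on_species Type_A (\<lambda>x. cup1_d_right l c x) q + single (Type_B, cup_pred l c) q)"
| "A_bar_Z l Type_B c = (\<lambda>q. single (Type_B, cup_succ l c) q +
     on_species Type_B (\<lambda>x. cup1_d_left l x c) q)"

lemma cup1_d_nonzero:
  "cup1_d_left l x c \<noteq> 0 \<Longrightarrow> x \<in> nbrs l c" "cup1_d_right l c x \<noteq> 0 \<Longrightarrow> x \<in> nbrs l c"
proof -
  assume "cup1_d_left l x c \<noteq> 0"
  then obtain k where "k \<in> snd c" "incidence x (cup1_pred l c k) \<noteq> 0"
    unfolding cup1_d_left_def by (rule sum.not_neutral_contains_not_neutral)
  thus "x \<in> nbrs l c" using incidence_nonzero unfolding nbrs_def by blast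
next
  assume "cup1_d_right l c x \<noteq> 0"
  then obtain k where "k \<in> snd c" "incidence x (cup1_succ l c k) \<noteq> 0"
    unfolding cup1_d_right_def by (rule sum.not_neutral_contains_not_neutral)
  thus "x \<in> nbrs l c" using incidence_nonzero unfolding nbrs_def by blast
qed

lemma supp_A_Z: "supp (A_Z l \<alpha> c) \<subseteq> UNIV \<times> nbrs l c" "supp (A_bar_Z l \<alpha> c) \<subseteq> UNIV \<times> nbrs l c"
proof -
  have single: "single (\<beta>, cup_succ l c) (\<gamma>, x) = 0" "single (\<beta>, cup_pred l c) (\<gamma>, x) = 0"
    if "x \<notin> nbrs l c" for \<beta> \<gamma> x
    using that by (auto simp: single_def nbrs_def)
  have d: "cup1_d_left l x c = 0" "cup1_d_right l c x = 0" if "x \<notin> nbrs l c" for x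
    using that cup1_d_nonzero by blast+
  have zero: "A_Z l \<alpha> c (\<gamma>, x) = 0" "A_bar_Z l \<alpha> c (\<gamma>, x) = 0" if "x \<notin> nbrs l c" for \<gamma> x
    by (cases \<alpha>; simp add: single[OF that] d[OF that])+
  show "supp (A_Z l \<alpha> c) \<subseteq> UNIV \<times> nbrs l c" "supp (A_bar_Z l \<alpha> c) \<subseteq> UNIV \<times> nbrs l c"
    by (rule supp_subset_UNIV_times, erule zero)+
qed

lemma finite_supp_A_Z:
  assumes "c \<in> cells (2 * l) l"
  shows "finite (supp (A_Z l \<alpha> c))" "finite (supp (A_bar_Z l \<alpha> c))"
proof -
  have "finite ((UNIV :: species set) \<times> nbrs l c)"
    using finite_species finite_nbrs[OF assms] by simp
  thus "finite (supp (A_Z l \<alpha> c))" "finite (supp (A_bar_Z l \<alpha> c))"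
    by (rule finite_subset[OF supp_A_Z(1)], rule finite_subset[OF supp_A_Z(2)])
qed

lemma A_op_eq:
  assumes c: "c \<in> cells (2 * l) l"
  shows "A_op l \<alpha> c = pauli (single (\<alpha>, c)) (A_Z l \<alpha> c)"
    "A_bar_op l \<alpha> c = pauli (single (\<alpha>, c)) (A_bar_Z l \<alpha> c)"
proof -
  have fin: "finite (supp (on_species \<beta> (\<lambda>x. cup1_d_left l x c)))"
    "finite (supp (on_species \<beta> (\<lambda>x. cup1_d_right l c x)))" for \<beta>
    by (rule finite_supp_on_species[OF finite_nbrs[OF c]], erule cup1_d_nonzero)+
  have U: "U_op l \<beta> c = pauli (single (\<beta>, c)) (single (\<beta>, cup_succ l c))" for \<beta>
    unfolding U_op_def op_prod_cup_right[OF c] pauli_X_eq by (simp add: pauli_comp_Z)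
  show "A_op l \<alpha> c = pauli (single (\<alpha>, c)) (A_Z l \<alpha> c)"
    by (cases \<alpha>) (simp_all add: U op_prod_cup1_left[OF c, simplified]
        op_prod_cup1_right[OF c, simplified] op_prod_cup_right[OF c] pauli_comp_Z fin
        finite_supp_add)
  show "A_bar_op l \<alpha> c = pauli (single (\<alpha>, c)) (A_bar_Z l \<alpha> c)"
    by (cases \<alpha>) (simp_all add: U op_prod_cup1_left[OF c, simplified]
        op_prod_cup1_right[OF c, simplified] op_prod_cup_left[OF c] pauli_comp_Z fin
        finite_supp_add)
qed

text \<open>
  With one \<open>X\<close> factor each, two operators commute iff their \<open>Z\<close>-parts agree at each other's \<open>X\<close> factor. For
  equal species this is \<open>cup1_identity\<close>; for different species both values are \<open>0\<close> or both are the
  same cup product.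
\<close>

lemma A_op_commutes_A_bar_op:
  assumes c: "c \<in> cells (2 * l) l" and c': "c' \<in> cells (2 * l) l"
  shows "A_op l \<alpha> c \<circ> A_bar_op l \<beta> c' = A_bar_op l \<beta> c' \<circ> A_op l \<alpha> c"
proof -
  note id1 = cup1_identity[OF c c'] and id2 = cup1_identity[OF c' c]
  have move: "a + b = x + y \<Longrightarrow> a + x = b + y" for a b x y :: bit
    by (cases a; cases b; cases x; cases y) simp_all
  have "A_Z l \<alpha> c (\<beta>, c') = A_bar_Z l \<beta> c' (\<alpha>, c)"
  proof (cases \<alpha>; cases \<beta>)
    assume "\<alpha> = Type_A" "\<beta> = Type_A"
    thus ?thesis using move[OF id2[unfolded add.commute[of "of_bool (c = cup_succ l c')"]]]
      by (simp add: single_def)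
  next
    assume "\<alpha> = Type_A" "\<beta> = Type_B"
    thus ?thesis by (simp add: single_def)
  next
    assume "\<alpha> = Type_B" "\<beta> = Type_A"
    thus ?thesis using cup_succ_eq_iff[OF c c'] by (simp add: single_def)
  next
    assume "\<alpha> = Type_B" "\<beta> = Type_B"
    thus ?thesis using move[OF id1[unfolded add.commute[of "cup1_d_left l c c'"]]]
      by (simp add: single_def)
  qed
  thus ?thesis
    unfolding A_op_eq[OF c] A_op_eq[OF c']
    by (intro pauli_commute) (simp_all add: finite_supp_A_Z c c')
qed

section \<open>Generating the single-qubit Pauli operators\<close>

definition gens :: "nat \<Rightarrow> int \<Rightarrow> cell \<Rightarrow> qubit operator set" where
  "gens l r c = {T. \<exists>\<alpha>. \<exists>c'\<in>cells (2 * l) l. near r c c' \<and> (T = A_op l \<alpha> c' \<or> T = A_bar_op l \<alpha> c')}"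

lemma gens_mono: "near s c c' \<Longrightarrow> s + r \<le> R \<Longrightarrow> gens l r c' \<subseteq> gens l R c"
  unfolding gens_def using near_trans near_mono by blast

lemma supported_on_gens:
  assumes T: "T \<in> gens l r c"
  shows "supported_on (neighbourhood (qubits l) (qubit_dist l) (2 * int l * (r + 2)) {(\<alpha>, c)}) T"
proof -
  let ?N = "neighbourhood (qubits l) (qubit_dist l) (2 * int l * (r + 2)) {(\<alpha>, c)}"
  obtain \<beta> c' where c': "c' \<in> cells (2 * l) l" "near r c c'"
    and T: "T = A_op l \<beta> c' \<or> T = A_bar_op l \<beta> c'"
    using T unfolding gens_def by blast
  have N: "(\<gamma>, x) \<in> ?N" if "x \<in> cells (2 * l) l" "near (r + 2) c x" for \<gamma> x
    using that qubit_dist_near by (auto simp: neighbourhood_def qubits_def)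
  have nbrs: "UNIV \<times> nbrs l c' \<subseteq> ?N"
    using N near_trans[OF c'(2) near_nbrs] nbrs_in_cells[OF c'(1)] by auto
  have "supp (A_Z l \<beta> c') \<subseteq> ?N" "supp (A_bar_Z l \<beta> c') \<subseteq> ?N"
    by (rule subset_trans[OF supp_A_Z(1) nbrs], rule subset_trans[OF supp_A_Z(2) nbrs])
  moreover have "supp (single (\<beta>, c')) \<subseteq> ?N"
    using c' N near_mono[OF c'(2)] by simp
  ultimately show ?thesis
    using T unfolding A_op_eq[OF c'(1)]
    by (elim disjE) (simp_all only: supported_on_pauli finite_supp_A_Z[OF c'(1)] supp_single finite.intros)
qed

lemma gens_local: "gens l r c \<subseteq> local_operators (qubits l)"
proof
  fix T assume T: "T \<in> gens l r c"
  have "neighbourhood (qubits l) (qubit_dist l) R S \<subseteq> qubits l" for R S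
    by (auto simp: neighbourhood_def)
  hence "supported_on (qubits l) T"
    by (rule supported_on_mono[OF supported_on_gens[OF T, of Type_A]])
  thus "T \<in> local_operators (qubits l)" by (simp add: local_operators_def)
qed

lemma generated_A:
  assumes "c \<in> cells (2 * l) l" "near r c\<^sub>0 c"
  shows "generated (gens l r c\<^sub>0) (single (\<alpha>, c)) (A_Z l \<alpha> c)"
    "generated (gens l r c\<^sub>0) (single (\<alpha>, c)) (A_bar_Z l \<alpha> c)"
proof -
  have "pauli (single (\<alpha>, c)) (A_Z l \<alpha> c) \<in> gens l r c\<^sub>0"
    "pauli (single (\<alpha>, c)) (A_bar_Z l \<alpha> c) \<in> gens l r c\<^sub>0"
    using assms A_op_eq[symmetric] unfolding gens_def by blast+
  thus "generated (gens l r c\<^sub>0) (single (\<alpha>, c)) (A_Z l \<alpha> c)"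
    "generated (gens l r c\<^sub>0) (single (\<alpha>, c)) (A_bar_Z l \<alpha> c)"
    by (simp_all add: generated_def finite_supp_A_Z assms phase_product_base)
qed

fun other :: "species \<Rightarrow> species" where
  "other Type_A = Type_B"
| "other Type_B = Type_A"

lemma other_other [simp]: "other (other \<alpha>) = \<alpha>"
  by (cases \<alpha>) simp_all

text \<open>
  The cell at which the pair of species \<open>\<alpha>\<close> at a given cell leaves a single \<open>Z\<close> of the other species.
\<close>

fun partner :: "nat \<Rightarrow> species \<Rightarrow> cell \<Rightarrow> cell" where
  "partner l Type_A = cup_pred l"
| "partner l Type_B = cup_succ l"

lemma partner_in_cells: "a \<in> cells (2 * l) l \<Longrightarrow> partner l \<alpha> a \<in> cells (2 * l) l"
  by (cases \<alpha>) (simp_all add: cup_succ_in_cells cup_pred_in_cells)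

lemma partner_partner: "a \<in> cells (2 * l) l \<Longrightarrow> partner l \<alpha> (partner l (other \<alpha>) a) = a"
  using cup_succ_eq_iff[of a l "cup_succ l a"] cup_succ_eq_iff[of "cup_pred l a" l a]
  by (cases \<alpha>) (auto simp: cup_succ_in_cells cup_pred_in_cells)

lemma near_partner: "near 1 c (partner l \<alpha> c)"
  by (cases \<alpha>) (simp_all add: near_partners)

definition cup1_comm :: "nat \<Rightarrow> cell \<Rightarrow> cell \<Rightarrow> bit" where
  "cup1_comm l a x = cup1_d_left l x a + cup1_d_right l a x"

text \<open>
  The \<open>X\<close> factors cancel, and so do the cup products that occur in both operators.
\<close>

lemma generated_pair:
  assumes a: "a \<in> cells (2 * l) l" "near r c a"
  shows "generated (gens l r c) no_qubit
    (\<lambda>q. on_species \<alpha> (cup1_comm l a) q + single (other \<alpha>, partner l \<alpha> a) q)"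
proof -
  have "generated (gens l r c) (\<lambda>q. single (\<alpha>, a) q + single (\<alpha>, a) q)
    (\<lambda>q. A_Z l \<alpha> a q + A_bar_Z l \<alpha> a q)"
    using generated_A[OF a] by (intro generated_add[OF gens_local])
  moreover have "A_Z l \<alpha> a q + A_bar_Z l \<alpha> a q =
    on_species \<alpha> (cup1_comm l a) q + single (other \<alpha>, partner l \<alpha> a) q" for q
    by (cases \<alpha>) (simp_all add: cup1_comm_def[abs_def] on_species_add ac_simps)
  ultimately show ?thesis by simp
qed

text \<open>
  The cup products in the Leibniz rules for \<open>(a, x)\<close> and \<open>(x, a)\<close> are the same, so that \<open>a\<close> and \<open>x\<close> may be
  exchanged; the coboundary then acts on \<open>a\<close>.
\<close>

lemma cup1_comm_swap:
  assumes "a \<in> cells (2 * l) l" "x \<in> cells (2 * l) l"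
  shows "cup1_comm l a x = cup1_d_left l a x + cup1_d_right l x a"
proof -
  have "p + q = s + t \<Longrightarrow> q + p = u + v \<Longrightarrow> s + v = u + t" for p q s t u v :: bit
    by (cases p; cases q; cases s; cases t; cases u; cases v) simp_all
  from this[OF cup1_identity[OF assms(2,1)] cup1_identity[OF assms]]
  show ?thesis by (simp add: cup1_comm_def)
qed

lemma cup1_comm_zero: "a \<in> cells (2 * l) l \<Longrightarrow> x \<notin> cells (2 * l) l \<Longrightarrow> cup1_comm l a x = 0"
  using cup1_d_nonzero nbrs_in_cells unfolding cup1_comm_def by (metis add_0 subsetD)

text \<open>
  After the exchange of \<open>a\<close> and \<open>x\<close> every term is a value of \<open>\<delta>a\<close>, and the sum runs over the coboundary of
  \<open>(w, K)\<close>. This is where the products of \<open>W\<close> operators disappear.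
\<close>

lemma cup1_comm_coboundary:
  assumes l: "l \<ge> 1" and w: "w \<in> vertices (2 * l)" and K: "K \<subseteq> {1..2 * l}" "card K = l - 1"
  shows "(\<Sum>i\<in>{1..2 * l} - K. cup1_comm l (w, insert i K) x +
    cup1_comm l (unshift w {i}, insert i K) x) = 0"
proof -
  have fin: "finite K" using K finite_subset by blast
  have a: "(w, insert i K) \<in> cells (2 * l) l" "(unshift w {i}, insert i K) \<in> cells (2 * l) l"
    if "i \<in> {1..2 * l} - K" for i
    using that l w K fin unshift_in_vertices[OF w, of "{i}"] by (auto simp: cells_def)
  show ?thesis
  proof (cases "x \<in> cells (2 * l) l")
    case False
    thus ?thesis using a by (intro sum.neutral ballI) (simp add: cup1_comm_zero)
  next
    case x: True
    let ?b = "\<lambda>i t. incidence (w, insert i K) t + incidence (unshift w {i}, insert i K) t"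
    have dd: "(\<Sum>i\<in>{1..2 * l} - K. ?b i t) = 0" if "t \<in> cells (2 * l) (l + 1)" for t
      using that K coboundary_coboundary[of K "2 * l" "snd t" w "fst t"] by (auto simp: cells_def)
    have "(\<Sum>i\<in>{1..2 * l} - K. cup1_comm l (w, insert i K) x +
        cup1_comm l (unshift w {i}, insert i K) x) =
      (\<Sum>i\<in>{1..2 * l} - K. (\<Sum>k\<in>snd x. ?b i (cup1_pred l x k)) +
        (\<Sum>k\<in>snd x. ?b i (cup1_succ l x k)))"
      using a x by (intro sum.cong refl)
        (simp add: cup1_comm_swap cup1_d_left_def cup1_d_right_def sum.distrib ac_simps)
    also have "\<dots> = (\<Sum>k\<in>snd x. \<Sum>i\<in>{1..2 * l} - K. ?b i (cup1_pred l x k)) +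
        (\<Sum>k\<in>snd x. \<Sum>i\<in>{1..2 * l} - K. ?b i (cup1_succ l x k))"
      by (subst sum.distrib, intro arg_cong2[where f = "(+)"] sum.swap)
    also have "\<dots> = 0" using dd cup1_in_cells[OF x] by simp
    finally show ?thesis .
  qed
qed

text \<open>
  Multiply the pairs of the other species \<open>\<alpha>\<close> over the coboundary of the \<open>(l - 1)\<close>-cell \<open>(w, K)\<close> that is paired
  with \<open>t\<close> under the cup product. The part on species \<open>\<alpha>\<close> vanishes, and the partners of these cells are
  exactly the faces of \<open>t\<close>.
\<close>

lemma generated_W:
  assumes l: "l \<ge> 1" and t: "t \<in> cells (2 * l) (l + 1)"
  shows "generated (gens l 1 t) no_qubit (on_species \<beta> (\<lambda>x. incidence x t))"
proof -
  obtain u T where tu: "t = (u, T)" by (cases t)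
  let ?D = "{1..2 * l}"
  define K where "K = ?D - T"
  define \<alpha> where "\<alpha> = other \<beta>"
  \<comment> \<open>For \<open>\<alpha> = A\<close> partners precede, so \<open>t\<close> must precede \<open>(w, K)\<close>; for \<open>\<alpha> = B\<close> it is the reverse.\<close>
  define w where "w = (case \<alpha> of Type_A \<Rightarrow> shift u T | Type_B \<Rightarrow> unshift u K)"
  have u: "u \<in> vertices (2 * l)" and T: "T \<subseteq> ?D" "card T = l + 1" "finite T"
    using t by (auto simp: tu cells_def intro: finite_subset)
  have K: "K \<subseteq> ?D" "card K = l - 1" "?D - K = T" "finite K"
    using T by (auto simp: K_def card_Diff_subset)
  have w: "w \<in> vertices (2 * l)"
    using u T K by (auto simp: w_def shift_in_vertices unshift_in_vertices split: species.splits)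
  let ?a = "\<lambda>i. (w, insert i K)" and ?a' = "\<lambda>i. (unshift w {i}, insert i K)"
  have cells: "?a i \<in> cells (2 * l) l" "?a' i \<in> cells (2 * l) l" if "i \<in> T" for i
    using that l w K unshift_in_vertices[OF w, of "{i}"] by (auto simp: cells_def)
  have near: "near 1 t (?a i)" "near 1 t (?a' i)" if "i \<in> T" for i
    using that K by (auto simp: near_def tu w_def shift_def unshift_def split: species.splits)
  have partner: "partner l \<alpha> (?a i) = (shift u {i}, T - {i})" "partner l \<alpha> (?a' i) = (u, T - {i})"
    if "i \<in> T" for i
  proof -
    have iK: "?D - insert i K = T - {i}" "i \<notin> K" using K that by auto
    show "partner l \<alpha> (?a i) = (shift u {i}, T - {i})" "partner l \<alpha> (?a' i) = (u, T - {i})"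
      using that iK(2)
      by (cases \<alpha>; simp only: partner.simps cup_pred_def cup_succ_def prod.case iK(1) w_def
          species.case; auto simp: fun_eq_iff shift_def unshift_def)+
  qed
  let ?v = "\<lambda>a q. on_species \<alpha> (cup1_comm l a) q + single (\<beta>, partner l \<alpha> a) q"
  have v: "generated (gens l 1 t) no_qubit (?v (?a i))"
    "generated (gens l 1 t) no_qubit (?v (?a' i))" if "i \<in> T" for i
    using generated_pair[OF cells(1) near(1), OF that that, of \<alpha>]
      generated_pair[OF cells(2) near(2), OF that that, of \<alpha>]
    by (simp_all add: \<alpha>_def)
  have "generated (gens l 1 t) no_qubit (\<lambda>q. ?v (?a i) q + ?v (?a' i) q)" if "i \<in> T" for i
    using generated_add[OF gens_local v(1) v(2), OF that that] by simp
  hence "generated (gens l 1 t) (\<lambda>q. \<Sum>i\<in>T. no_qubit q) (\<lambda>q. \<Sum>i\<in>T. ?v (?a i) q + ?v (?a' i) q)"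
    using T by (intro generated_sum[OF gens_local])
  moreover have "(\<Sum>i\<in>T. ?v (?a i) q + ?v (?a' i) q) = on_species \<beta> (\<lambda>x. incidence x t) q" for q
  proof -
    obtain \<gamma> x where q: "q = (\<gamma>, x)" by (cases q)
    have "(\<Sum>i\<in>T. ?v (?a i) q + ?v (?a' i) q) =
      of_bool (\<gamma> = \<alpha>) * (\<Sum>i\<in>T. cup1_comm l (?a i) x + cup1_comm l (?a' i) x) +
      (\<Sum>i\<in>T. single (\<beta>, partner l \<alpha> (?a i)) q + single (\<beta>, partner l \<alpha> (?a' i)) q)"
      by (simp add: q sum.distrib sum_distrib_left ac_simps)
    also have "(\<Sum>i\<in>T. cup1_comm l (?a i) x + cup1_comm l (?a' i) x) = 0"
      using cup1_comm_coboundary[OF l w K(1,2)] unfolding K(3) .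
    also have "(\<Sum>i\<in>T. single (\<beta>, partner l \<alpha> (?a i)) q + single (\<beta>, partner l \<alpha> (?a' i)) q) =
      on_species \<beta> (\<lambda>x. incidence x t) q"
      unfolding tu q on_species_apply incidence_eq sum_distrib_left
      by (intro sum.cong) (auto simp: partner single_def)
    finally show ?thesis by simp
  qed
  ultimately show ?thesis by simp
qed

text \<open>
  The pair at the partner of \<open>c\<close> gives the wanted \<open>Z\<close> times operators \<open>W\<close> of the other species, which
  \<open>generated_W\<close> removes.
\<close>

lemma generated_Z:
  assumes l: "l \<ge> 1" and c: "c \<in> cells (2 * l) l"
  shows "generated (gens l 3 c) no_qubit (single (\<beta>, c))"
proof -
  define \<alpha> where "\<alpha> = other \<beta>"
  define a where "a = partner l \<beta> c"
  have a: "a \<in> cells (2 * l) l" "near 1 c a" "partner l \<alpha> a = c"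
    using c partner_partner[OF c, of \<alpha>]
    by (simp_all add: a_def \<alpha>_def partner_in_cells near_partner)
  have W: "generated (gens l 3 c) no_qubit (on_species \<alpha> (\<lambda>x. incidence x t))"
    if "t \<in> cells (2 * l) (l + 1)" "near 1 a t" for t
    by (rule generated_mono[OF generated_W[OF l that(1)] gens_mono[OF near_trans[OF a(2) that(2)]]])
      simp
  have sum: "generated (gens l 3 c) no_qubit (\<lambda>q. \<Sum>k\<in>snd a. on_species \<alpha> (\<lambda>x. incidence x (f k)) q)"
    if "\<And>k. k \<in> snd a \<Longrightarrow> f k \<in> cells (2 * l) (l + 1)" "\<And>k. near 1 a (f k)" for f
    using generated_sum[OF gens_local cell_finite[OF a(1)], of l 3 c "\<lambda>_. no_qubit"] W that
    by simp
  have "generated (gens l 3 c) no_qubit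
    (\<lambda>q. on_species \<alpha> (cup1_comm l a) q + single (\<beta>, c) q)"
    using generated_pair[OF a(1) near_mono[OF a(2)], of 3 \<alpha>] by (simp add: a(3)) (simp add: \<alpha>_def)
  from generated_add[OF gens_local this generated_add[OF gens_local sum sum, of "cup1_pred l a" "cup1_succ l a"]]
  have "generated (gens l 3 c) no_qubit (\<lambda>q. on_species \<alpha> (cup1_comm l a) q + single (\<beta>, c) q +
    ((\<Sum>k\<in>snd a. on_species \<alpha> (\<lambda>x. incidence x (cup1_pred l a k)) q) +
     (\<Sum>k\<in>snd a. on_species \<alpha> (\<lambda>x. incidence x (cup1_succ l a k)) q)))"
    using cup1_in_cells[OF a(1)] near_partners by simp
  moreover have "on_species \<alpha> (cup1_comm l a) q =
    (\<Sum>k\<in>snd a. on_species \<alpha> (\<lambda>x. incidence x (cup1_pred l a k)) q) +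
    (\<Sum>k\<in>snd a. on_species \<alpha> (\<lambda>x. incidence x (cup1_succ l a k)) q)" for q
    by (cases q) (simp add: cup1_comm_def cup1_d_left_def cup1_d_right_def sum_distrib_left
        distrib_left)
  moreover have "x + y + x = y" for x y :: bit
    by (cases x; cases y) simp_all
  ultimately show ?thesis by (simp only:)
qed

lemma generated_X:
  assumes l: "l \<ge> 1" and c: "c \<in> cells (2 * l) l"
  shows "generated (gens l 5 c) (single (\<alpha>, c)) no_qubit"
proof -
  have "generated (gens l 5 c) no_qubit (A_Z l \<alpha> c)"
  proof (rule generated_Z_part[OF gens_local finite_supp_A_Z(1)[OF c]])
    fix q assume "q \<in> supp (A_Z l \<alpha> c)"
    then obtain \<beta> x where q: "q = (\<beta>, x)" and x: "x \<in> nbrs l c" using supp_A_Z(1) by blast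
    show "generated (gens l 5 c) no_qubit (single q)"
      unfolding q
      by (rule generated_mono[OF generated_Z[OF l subsetD[OF nbrs_in_cells[OF c] x]]
            gens_mono[OF near_nbrs[OF x]]]) simp
  qed
  moreover have "generated (gens l 5 c) (single (\<alpha>, c)) (A_Z l \<alpha> c)"
    by (rule generated_A(1)[OF c near_mono[OF near_refl]]) simp
  ultimately have "generated (gens l 5 c) (\<lambda>q. no_qubit q + single (\<alpha>, c) q)
    (\<lambda>q. A_Z l \<alpha> c q + A_Z l \<alpha> c q)"
    by (rule generated_add[OF gens_local])
  thus ?thesis by simp
qed

theorem mainTheorem5:
  fixes l :: nat
  assumes "l \<ge> 1"
  shows "invertible_subalgebra (qubits l) (qubit_dist l) (subalgebra (qubits l) hull A_generators l)
    \<and> (\<forall>\<alpha> \<beta>. \<forall>c\<in>cells (2 * l) l. \<forall>c'\<in>cells (2 * l) l.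
         A_op l \<alpha> c \<circ> A_bar_op l \<beta> c' = A_bar_op l \<beta> c' \<circ> A_op l \<alpha> c)
    \<and> (\<exists>r. \<forall>\<alpha>. \<forall>c\<in>cells (2 * l) l. \<forall>P\<in>{pauli_X (\<alpha>, c), pauli_Z (\<alpha>, c)}.
         \<exists>z Ts. norm z = 1 \<and>
           (\<forall>T\<in>set Ts. T \<in> A_generators l \<union> A_bar_generators l \<and>
              supported_on (neighbourhood (qubits l) (qubit_dist l) r {(\<alpha>, c)}) T) \<and>
           P = scale_op z (foldr (\<circ>) Ts id))"
proof -
  \<comment> \<open>\<open>X\<close> needs generators within 5 of the cell in each coordinate, and a generator reaches 2 further; \<open>2 * l\<close> is the number of coordinates.\<close>
  define r where "r = 2 * int l * (5 + 2)"
  let ?N = "neighbourhood (qubits l) (qubit_dist l) r"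
  let ?G = "\<lambda>q. {T \<in> A_generators l \<union> A_bar_generators l. supported_on (?N {q}) T}"
  have gens: "gens l 5 c \<subseteq> ?G (\<alpha>, c)" for \<alpha> c
    using supported_on_gens[of _ l 5 c \<alpha>]
    unfolding r_def gens_def A_generators_def A_bar_generators_def by blast
  have local: "T \<in> local_operators (qubits l)" if T: "T \<in> A_generators l \<union> A_bar_generators l" for T
  proof -
    obtain \<alpha> c where "c \<in> cells (2 * l) l" "T = A_op l \<alpha> c \<or> T = A_bar_op l \<alpha> c"
      using T by (auto simp: A_generators_def A_bar_generators_def)
    hence "T \<in> gens l 0 c" using near_refl unfolding gens_def by blast
    thus ?thesis by (rule subsetD[OF gens_local])
  qed
  have generated: "phase_product (?G (\<alpha>, c)) P"
    if c: "c \<in> cells (2 * l) l" and P: "P \<in> {pauli_X (\<alpha>, c), pauli_Z (\<alpha>, c)}" for \<alpha> c P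
  proof -
    have "generated (gens l 5 c) no_qubit (single (\<alpha>, c))"
      by (rule generated_mono[OF generated_Z[OF assms c] gens_mono[OF near_refl]]) simp
    hence "phase_product (gens l 5 c) P"
      using P generated_X[OF assms c, of \<alpha>] by (auto simp: generated_def pauli_X_eq pauli_Z_eq)
    thus ?thesis using gens by (rule phase_product_mono)
  qed
  have commute: "A_op l \<alpha> c \<circ> A_bar_op l \<beta> c' = A_bar_op l \<beta> c' \<circ> A_op l \<alpha> c"
    if "c \<in> cells (2 * l) l" "c' \<in> cells (2 * l) l" for \<alpha> \<beta> c c'
    using that by (rule A_op_commutes_A_bar_op)
  have "invertible_subalgebra (qubits l) (qubit_dist l) (subalgebra (qubits l) hull A_generators l)"
  proof (rule invertible_subalgebra_hull)
    show "A_generators l \<subseteq> local_operators (qubits l)" "A_bar_generators l \<subseteq> local_operators (qubits l)"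
      using local by blast+
    show "S \<circ> T = T \<circ> S" if "S \<in> A_generators l" "T \<in> A_bar_generators l" for S T
      using that commute unfolding A_generators_def A_bar_generators_def by blast
    show "phase_product (?G q) P" if "q \<in> qubits l" "P \<in> {pauli_X q, pauli_Z q}" for q P
      using that generated by (cases q) (auto simp: qubits_def)
  qed
  moreover have "\<exists>z Ts. norm z = 1 \<and>
      (\<forall>T\<in>set Ts. T \<in> A_generators l \<union> A_bar_generators l \<and> supported_on (?N {(\<alpha>, c)}) T) \<and>
      P = scale_op z (foldr (\<circ>) Ts id)"
    if "c \<in> cells (2 * l) l" "P \<in> {pauli_X (\<alpha>, c), pauli_Z (\<alpha>, c)}" for \<alpha> c P
    using generated[OF that] unfolding phase_product_def by blast
  ultimately show ?thesis using commute by blast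
qed

end
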